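(* Let $\psi:\mathbb N\to(0,1]$ be a non-increasing function such that $q^{2}\cdot\psi(q)\to 0$ as $q\to\infty$. Assume that the upper order at infinity and the lower order at infinity of the function $1/\psi$ coincide and are equal to a number $\lambda\geq 2$. Then, for every integer $n\geq 3$, one has $$\dim E(n,\psi)=\dim W(n,\psi)=\frac{n+1}{\lambda},$$ where $\dim$ denotes the Hausdorff dimension.
   Context: Here $\mathbb N$ denotes the positive integers. For an integer $n\geq 1$ and a function $\psi:\mathbb N\to(0,1]$, the set of $\psi$-simultaneously-well-approximable vectors is $$W(n,\psi):=\left\{\boldsymbol\alpha\in[0,1]^n:\ \max_{1\leq i\leq n}\left|\alpha_i-\frac{p_i}{q}\right|<\psi(q)\ \text{for infinitely many } q\in\mathbb N,\ \boldsymbol p\in\mathbb Z^n\right\},$$ and the set of $\psi$-exactly approximable vectors is $$E(n,\psi):=W(n,\psi)\setminus\bigcup_{0<c<1}W(n,c\psi).$$ The lower order at infinity of a function $g:\mathbb N\to(0,+\infty)$ is $\liminf_{x\to\infty}\frac{\log g(x)}{\log x}$, and its upper order at infinity is $\limsup_{x\to\infty}\frac{\log g(x)}{\log x}$. *)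

theory Defs
  imports "HOL-Analysis.Analysis"
begin

text \<open>
  The summand \<open>diam(U)\<^sup>s\<close> with the conventions \<open>diam(\<emptyset>)\<^sup>s = 0\<close> and \<open>diam(U)\<^sup>0 = 1\<close> for
  nonempty \<open>U\<close>; the case \<open>s = 0\<close> is separate because \<open>0 powr 0 = 0\<close> in HOL.
\<close>

definition hausdorff_weight :: "real \<Rightarrow> 'a::metric_space set \<Rightarrow> ennreal" where
  "hausdorff_weight s U =
     (if U = {} then 0 else if s = 0 then 1 else ennreal (diameter U powr s))"

text \<open>
  Boundedness is required explicitly since \<^const>\<open>diameter\<close> is a real number, with no meaningful
  value on unbounded sets. Finite covers are included by padding with empty sets.
\<close>

definition hausdorff_covers :: "real \<Rightarrow> 'a::metric_space set \<Rightarrow> (nat \<Rightarrow> 'a set) set" where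
  "hausdorff_covers \<delta> X =
     {U. X \<subseteq> (\<Union>i. U i) \<and> (\<forall>i. bounded (U i) \<and> diameter (U i) \<le> \<delta>)}"

definition hausdorff_premeasure :: "real \<Rightarrow> real \<Rightarrow> 'a::metric_space set \<Rightarrow> ennreal" where
  "hausdorff_premeasure s \<delta> X = (INF U\<in>hausdorff_covers \<delta> X. \<Sum>i. hausdorff_weight s (U i))"

definition hausdorff_measure :: "real \<Rightarrow> 'a::metric_space set \<Rightarrow> ennreal" where
  "hausdorff_measure s X = (SUP \<delta>\<in>{0<..}. hausdorff_premeasure s \<delta> X)"

definition hausdorff_dim :: "'a::metric_space set \<Rightarrow> ereal" where
  "hausdorff_dim X = (INF s\<in>{s. 0 \<le> s \<and> hausdorff_measure s X = 0}. ereal s)"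

text \<open>
  A function on the positive integers is represented by a function on \<^typ>\<open>nat\<close> whose value at
  \<open>0\<close> is never used. The dimension \<open>n\<close> is \<open>CARD('n)\<close>.
\<close>

definition well_approximable :: "(nat \<Rightarrow> real) \<Rightarrow> (real ^ 'n) set" where
  "well_approximable \<psi> =
     {\<alpha>. (\<forall>i. \<alpha> $ i \<in> {0..1}) \<and>
          infinite {(q :: nat, p :: int ^ 'n).
            1 \<le> q \<and> (MAX i. \<bar>\<alpha> $ i - of_int (p $ i) / of_nat q\<bar>) < \<psi> q}}"

definition exactly_approximable :: "(nat \<Rightarrow> real) \<Rightarrow> (real ^ 'n) set" where
  "exactly_approximable \<psi> =
     well_approximable \<psi> - (\<Union>c\<in>{0<..<1}. well_approximable (\<lambda>q. c * \<psi> q))"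

definition lower_order :: "(nat \<Rightarrow> real) \<Rightarrow> ereal" where
  "lower_order g = liminf (\<lambda>x. ereal (ln (g x) / ln (real x)))"

definition upper_order :: "(nat \<Rightarrow> real) \<Rightarrow> ereal" where
  "upper_order g = limsup (\<lambda>x. ereal (ln (g x) / ln (real x)))"

end

theory Submission
  imports Defs "HOL-Real_Asymp.Real_Asymp"
begin

text \<open>
  Write \<open>n\<close> for the dimension and \<open>W\<close>, \<open>E\<close> for the sets of well and of exactly approximable
  vectors. The set \<open>W\<close> consists of the points that lie in infinitely many cubes of radius
  \<open>\<psi>(q)\<close> about rational points \<open>p/q\<close>. About \<open>q\<^sup>n\<close> numerators \<open>p\<close> matter for each \<open>q\<close>, and
  \<open>\<psi>(q)\<close> is \<open>q\<close> to the power \<open>-lam + o(1)\<close>, so the tails of this family of cubes are covers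
  that give \<open>dim W \<le> (n + 1) / lam\<close>. As \<open>E \<subseteq> W\<close>, it remains to bound \<open>dim E\<close> from below.

  A vector \<open>\<alpha>\<close> is outside \<open>W(c\<psi>)\<close> as soon as a single coordinate satisfies
  \<open>\<bar>\<alpha>\<^sub>i - r/s\<bar> \<ge> c\<psi>(s)\<close> for all fractions with large denominator. So exactness is imposed on one
  fixed coordinate \<open>i0\<close>, and the other coordinates only have to follow the approximations. Along a
  rapidly growing sequence of denominators \<open>q\<^sub>k\<close>, coordinate \<open>i0\<close> is put at a distance between
  \<open>(1 - \<eta>\<^sub>k)\<psi>(q\<^sub>k)\<close> and \<open>(1 - \<eta>\<^sub>k/2)\<psi>(q\<^sub>k)\<close> to the right of a reduced fraction with denominator
  \<open>q\<^sub>k\<close>, where \<open>\<eta>\<^sub>k\<close> tends to \<open>0\<close>; every other coordinate is put within \<open>\<psi>(q\<^sub>k)/2\<close> of a fraction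
  with the same denominator. These boxes are the nodes of a tree, and a point that follows a path
  of the tree is in \<open>E\<close> provided that coordinate \<open>i0\<close> stays away from all other fractions with
  denominators between \<open>q\<^sub>k\<close> and \<open>q\<^sub>k\<^sub>+\<^sub>1\<close> (\<open>path_exactly_approximable\<close>).

  That condition costs almost nothing. Because \<open>q\<^sup>2\<psi>(q)\<close> tends to \<open>0\<close>, it suffices that
  coordinate \<open>i0\<close> is badly approximable with a small constant in this range. Following Jarnik, cut
  an interval repeatedly into \<open>b\<close> parts: each time only one fraction matters, and it spoils at most
  three parts (\<open>badly_approximable_tree\<close>). Dirichlet's theorem then finds in each surviving
  interval a reduced fraction whose denominator is comparable to a common bound \<open>N\<close>
  (\<open>separated_fractions\<close>). With \<open>\<theta> = log (b - 3) / log b\<close>, close to \<open>1\<close>, a node has about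
  \<open>N\<close> to the power \<open>2\<theta>\<close> choices in coordinate \<open>i0\<close>, each of them with about \<open>N\<close> to the power
  \<open>n - 1\<close> choices in the other coordinates, and the boxes chosen have size \<open>\<psi>(N)\<close>. For
  \<open>t < (n + 1) / lam\<close> this exceeds the inverse of \<open>\<psi>(N)\<^sup>t\<close>.

  Spread mass uniformly over the tree. By the mass distribution principle
  (\<open>hausdorff_measure_limit_set\<close>) it is enough that a set \<open>U\<close> of diameter \<open>d\<close> that meets two
  children of a node with denominator \<open>q\<close> meets at most a proportion \<open>C(d/\<psi>(q))\<^sup>t\<close> of them. The
  fractions in coordinate \<open>i0\<close> are separated by a multiple of \<open>1/N\<^sup>2\<close>, so \<open>d\<close> is at least of that
  order. If \<open>d \<ge> 1/N\<close>, the coordinates other than \<open>i0\<close> already give the proportion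
  \<open>(d/\<psi>(q))\<close> to the power \<open>n - 1\<close> (\<open>spread_coarse\<close>); this is where \<open>n \<ge> 3\<close> enters, through
  \<open>t < (n + 1) / lam \<le> (n + 1) / 2 \<le> n - 1\<close>. If \<open>d < 1/N\<close>, the other coordinates leave a bounded
  number of choices and coordinate \<open>i0\<close> leaves about \<open>dN\<^sup>2\<close>, which is small enough because
  \<open>t < (n + 1) / 2\<close> (\<open>spread_fine\<close>).
\<close>

section \<open>Hausdorff dimension and mass distributions on trees\<close>

lemma hausdorff_premeasure_mono_set:
  "X \<subseteq> Y \<Longrightarrow> hausdorff_premeasure s \<delta> X \<le> hausdorff_premeasure s \<delta> Y"
  unfolding hausdorff_premeasure_def hausdorff_covers_def
  by (rule INF_superset_mono) auto

lemma hausdorff_measure_mono_set: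
  "X \<subseteq> Y \<Longrightarrow> hausdorff_measure s X \<le> hausdorff_measure s Y"
  unfolding hausdorff_measure_def by (intro SUP_mono' hausdorff_premeasure_mono_set)

lemma hausdorff_dim_mono:
  assumes "X \<subseteq> Y"
  shows "hausdorff_dim X \<le> hausdorff_dim Y"
  unfolding hausdorff_dim_def
proof (rule INF_superset_mono)
  show "{s. 0 \<le> s \<and> hausdorff_measure s Y = 0} \<subseteq> {s. 0 \<le> s \<and> hausdorff_measure s X = 0}"
    using hausdorff_measure_mono_set[OF assms] by (auto simp: le_zero_eq) (metis le_zero_eq)
qed auto

lemma hausdorff_dim_leI:
  assumes "0 \<le> s" "\<And>u. s < u \<Longrightarrow> hausdorff_measure u X = 0"
  shows "hausdorff_dim X \<le> ereal s"
proof (rule ereal_le_epsilon2)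
  fix \<epsilon> :: real assume "0 < \<epsilon>"
  with assms show "hausdorff_dim X \<le> ereal s + ereal \<epsilon>"
    unfolding hausdorff_dim_def by (auto intro!: INF_lower2[of "s + \<epsilon>"])
qed

lemma hausdorff_measure_zero_ne_0:
  fixes X :: "'a::metric_space set"
  assumes "X \<noteq> {}"
  shows "hausdorff_measure 0 X \<noteq> 0"
proof -
  have "1 \<le> (\<Sum>i. hausdorff_weight 0 (U i))" if U: "U \<in> hausdorff_covers 1 X" for U
  proof -
    from U assms obtain i where "U i \<noteq> {}" unfolding hausdorff_covers_def by blast
    then have "1 = (\<Sum>j\<in>{i}. hausdorff_weight 0 (U j))" by (simp add: hausdorff_weight_def)
    also have "\<dots> \<le> (\<Sum>j. hausdorff_weight 0 (U j))" by (rule sum_le_suminf) auto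
    finally show ?thesis .
  qed
  then have "1 \<le> hausdorff_premeasure 0 1 X"
    unfolding hausdorff_premeasure_def by (intro INF_greatest)
  also have "\<dots> \<le> hausdorff_measure 0 X"
    unfolding hausdorff_measure_def by (rule SUP_upper) simp
  finally show ?thesis by auto
qed

lemma hausdorff_measure_empty: "0 < s \<Longrightarrow> hausdorff_measure s {} = 0"
proof -
  assume "0 < s"
  have "hausdorff_premeasure s \<delta> {} \<le> 0" if "\<delta> > 0" for \<delta>
    unfolding hausdorff_premeasure_def
    by (rule INF_lower2[of "\<lambda>_. {}"]) (use that in \<open>auto simp: hausdorff_covers_def hausdorff_weight_def\<close>)
  then show ?thesis unfolding hausdorff_measure_def
    by (intro antisym SUP_least) auto
qed

text \<open>
  The exponent \<open>0\<close> needs its own argument, because it is not among the exponents of the hypothesis.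
\<close>

lemma hausdorff_dim_geI:
  assumes "0 < s" "\<And>u. 0 < u \<Longrightarrow> u < s \<Longrightarrow> hausdorff_measure u X \<noteq> 0"
  shows "ereal s \<le> hausdorff_dim X"
  unfolding hausdorff_dim_def
proof (rule INF_greatest, clarsimp)
  fix u :: real assume u: "0 \<le> u" "hausdorff_measure u X = 0"
  have "X \<noteq> {}" using assms(2)[of "s/2"] assms(1) hausdorff_measure_empty[of "s/2"] by auto
  then have "u \<noteq> 0" using u hausdorff_measure_zero_ne_0 by auto
  then show "s \<le> u" using assms(2)[of u] u by force
qed

text \<open>
  A mass that splits equally among the children of each node. The assumption \<open>many\<close> keeps the mass
  of each child below \<open>\<rho> c powr t\<close>, and \<open>spread\<close> bounds the share of the children that a set of
  diameter at most \<open>d\<close> can meet when it does not fit into a single child.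
\<close>

locale mass_tree =
  fixes V :: "'v set" and ch :: "'v \<Rightarrow> 'v set" and B :: "'v \<Rightarrow> 'a::heine_borel set"
    and \<rho> :: "'v \<Rightarrow> real" and C t :: real
  assumes t_pos: "0 < t" and C_ge1: "1 \<le> C"
    and ch_sub: "\<And>v. v \<in> V \<Longrightarrow> ch v \<subseteq> V"
    and ch_fin: "\<And>v. v \<in> V \<Longrightarrow> finite (ch v)"
    and ch_ne: "\<And>v. v \<in> V \<Longrightarrow> ch v \<noteq> {}"
    and B_compact: "\<And>v. v \<in> V \<Longrightarrow> compact (B v)"
    and B_ne: "\<And>v. v \<in> V \<Longrightarrow> B v \<noteq> {}"
    and B_mono: "\<And>v c. v \<in> V \<Longrightarrow> c \<in> ch v \<Longrightarrow> B c \<subseteq> B v"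
    and \<rho>_pos: "\<And>v. v \<in> V \<Longrightarrow> 0 < \<rho> v"
    and \<rho>_le1: "\<And>v. v \<in> V \<Longrightarrow> \<rho> v \<le> 1"
    and \<rho>_half: "\<And>v c. v \<in> V \<Longrightarrow> c \<in> ch v \<Longrightarrow> 2 * \<rho> c \<le> \<rho> v"
    and many: "\<And>v c. v \<in> V \<Longrightarrow> c \<in> ch v \<Longrightarrow> 1 \<le> real (card (ch v)) * \<rho> c powr t"
    and spread: "\<And>v U d. v \<in> V \<Longrightarrow> 0 < d \<Longrightarrow> (\<And>x y. x \<in> U \<Longrightarrow> y \<in> U \<Longrightarrow> dist x y \<le> d) \<Longrightarrow>
        card {c \<in> ch v. B c \<inter> U \<noteq> {}} \<le> 1 \<or>
        real (card {c \<in> ch v. B c \<inter> U \<noteq> {}}) \<le> C * (d / \<rho> v) powr t * real (card (ch v))"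
begin

primrec level_set :: "nat \<Rightarrow> 'v \<Rightarrow> 'a set" where
  "level_set 0 v = B v"
| "level_set (Suc m) v = (\<Union>c\<in>ch v. level_set m c)"

definition limit_set :: "'v \<Rightarrow> 'a set" where
  "limit_set v = (\<Inter>m. level_set m v)"

text \<open>
  The share of the nodes at depth \<open>m\<close> below \<open>v\<close> that meet \<open>U\<close>, each node being weighted by its mass.
  Counting at finite depth replaces a limit measure: compactness reduces a countable cover of the
  limit set to a finite cover of some level.
\<close>

primrec mass :: "'a set \<Rightarrow> nat \<Rightarrow> 'v \<Rightarrow> real" where
  "mass U 0 v = (if B v \<inter> U = {} then 0 else 1)"
| "mass U (Suc m) v = (\<Sum>c\<in>ch v. mass U m c) / real (card (ch v))"

lemma level_set_compact: "v \<in> V \<Longrightarrow> compact (level_set m v)"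
  using ch_sub ch_fin by (induction m arbitrary: v) (auto intro!: compact_UN B_compact)

lemma level_set_Suc_subset: "v \<in> V \<Longrightarrow> level_set (Suc m) v \<subseteq> level_set m v"
proof (induction m arbitrary: v)
  case 0
  then show ?case using B_mono by auto
next
  case (Suc m)
  have "level_set (Suc (Suc m)) v = (\<Union>c\<in>ch v. level_set (Suc m) c)" by (rule level_set.simps)
  also have "\<dots> \<subseteq> (\<Union>c\<in>ch v. level_set m c)"
    using ch_sub[OF Suc.prems] Suc.IH by (intro UN_mono) auto
  finally show ?case by simp
qed

lemma level_set_antimono: "v \<in> V \<Longrightarrow> m \<le> m' \<Longrightarrow> level_set m' v \<subseteq> level_set m v"
  using lift_Suc_antimono_le[of "\<lambda>m. level_set m v", OF level_set_Suc_subset] by simp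

lemma card_ch_pos: "v \<in> V \<Longrightarrow> 0 < card (ch v)"
  by (simp add: ch_fin ch_ne card_gt_0_iff)

lemma mass_nonneg: "0 \<le> mass U m v"
  by (induction m arbitrary: v) (auto intro!: divide_nonneg_nonneg sum_nonneg)

lemma mass_le_1: "v \<in> V \<Longrightarrow> mass U m v \<le> 1"
proof (induction m arbitrary: v)
  case (Suc m)
  have "(\<Sum>c\<in>ch v. mass U m c) \<le> (\<Sum>c\<in>ch v. 1)"
    using Suc ch_sub by (intro sum_mono) auto
  then show ?case using card_ch_pos[OF Suc.prems] by (simp add: field_simps)
qed auto

lemma mass_disjoint: "v \<in> V \<Longrightarrow> B v \<inter> U = {} \<Longrightarrow> mass U m v = 0"
proof (induction m arbitrary: v)
  case (Suc m)
  have "mass U m c = 0" if "c \<in> ch v" for c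
    using Suc.IH[of c] Suc.prems that ch_sub[of v] B_mono[of v c] by blast
  then show ?case by simp
qed auto

lemma mass_Suc_met:
  assumes "v \<in> V"
  shows "mass U (Suc m) v = (\<Sum>c\<in>{c \<in> ch v. B c \<inter> U \<noteq> {}}. mass U m c) / card (ch v)"
proof -
  have "(\<Sum>c\<in>ch v. mass U m c) = (\<Sum>c\<in>{c \<in> ch v. B c \<inter> U \<noteq> {}}. mass U m c)"
    using assms ch_fin mass_disjoint ch_sub
    by (intro sum.mono_neutral_right) (auto, blast)
  then show ?thesis by simp
qed

text \<open>
  A set that meets only one child \<open>c\<close> passes to \<open>c\<close> with its mass divided by the number of children,
  and \<open>many\<close> says that this division pays for replacing \<open>\<rho> v\<close> by \<open>\<rho> c\<close>. The first time that the
  set meets several children, \<open>spread\<close> gives the bound. The condition on \<open>m\<close> ensures that this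
  happens, or that the node has become smaller than \<open>d\<close>, before the depth is used up.
\<close>

lemma mass_le_powr:
  assumes "v \<in> V" "0 < d" "\<And>x y. x \<in> U \<Longrightarrow> y \<in> U \<Longrightarrow> dist x y \<le> d" "\<rho> v \<le> 2 ^ m * d"
  shows "mass U m v \<le> C * (d / \<rho> v) powr t"
  using assms
proof (induction m arbitrary: v)
  case 0
  have "1 \<le> d / \<rho> v" using 0 \<rho>_pos by simp
  then have "1 \<le> (d / \<rho> v) powr t" using t_pos by (simp add: ge_one_powr_ge_zero)
  then have "1 * 1 \<le> C * (d / \<rho> v) powr t" using C_ge1 by (intro mult_mono) auto
  then show ?case by simp
next
  case (Suc m)
  note v = Suc.prems(1)
  let ?S = "{c \<in> ch v. B c \<inter> U \<noteq> {}}"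
  have fin: "finite ?S" using ch_fin[OF v] by auto
  note pos = card_ch_pos[OF v]
  have S_le: "mass U (Suc m) v \<le> card ?S / card (ch v)"
  proof -
    have "(\<Sum>c\<in>?S. mass U m c) \<le> (\<Sum>c\<in>?S. 1)"
      using ch_sub[OF v] by (intro sum_mono mass_le_1) auto
    then show ?thesis unfolding mass_Suc_met[OF v] by (intro divide_right_mono) auto
  qed
  consider "card ?S = 0" | "card ?S = 1" | "real (card ?S) \<le> C * (d / \<rho> v) powr t * real (card (ch v))"
    using spread[OF v Suc.prems(2,3)] by fastforce
  then show ?case
  proof cases
    case 1
    then have "mass U (Suc m) v \<le> 0" using S_le by simp
    also have "0 \<le> C * (d / \<rho> v) powr t" using C_ge1 by simp
    finally show ?thesis .
  next
    case 2
    then obtain c where c: "?S = {c}" by (auto simp: card_1_singleton_iff)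
    then have cc: "c \<in> ch v" by auto
    then have cV: "c \<in> V" using ch_sub v by auto
    have "\<rho> c \<le> 2 ^ m * d" using \<rho>_half[OF v cc] Suc.prems(4) by simp
    from Suc.IH[OF cV Suc.prems(2,3) this] have IH: "mass U m c \<le> C * (d / \<rho> c) powr t" .
    have "mass U (Suc m) v = mass U m c / card (ch v)"
      unfolding mass_Suc_met[OF v] c by simp
    also have "\<dots> \<le> C * (d / \<rho> c) powr t / card (ch v)"
      using IH pos by (intro divide_right_mono) auto
    also have "\<dots> \<le> C * (d / \<rho> c) powr t * \<rho> c powr t"
    proof -
      have "1 / card (ch v) \<le> \<rho> c powr t" using many[OF v cc] pos by (simp add: field_simps)
      then have "C * (d / \<rho> c) powr t * (1 / card (ch v)) \<le> C * (d / \<rho> c) powr t * \<rho> c powr t"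
        using C_ge1 by (intro mult_left_mono) auto
      then show ?thesis by simp
    qed
    also have "\<dots> = C * d powr t"
      using \<rho>_pos[OF cV] Suc.prems(2) by (simp add: powr_divide)
    also have "\<dots> \<le> C * (d / \<rho> v) powr t"
    proof -
      have "d \<le> d / \<rho> v" using \<rho>_pos[OF v] \<rho>_le1[OF v] Suc.prems(2)
        by (simp add: field_simps)
      then show ?thesis using C_ge1 t_pos Suc.prems(2) by (intro mult_left_mono powr_mono2) auto
    qed
    finally show ?thesis .
  next
    case 3
    then have "card ?S / card (ch v) \<le> C * (d / \<rho> v) powr t" using pos by (simp add: field_simps)
    then show ?thesis using S_le by linarith
  qed
qed

lemma mass_cover:
  assumes "v \<in> V" "finite I" "level_set m v \<subseteq> (\<Union>i\<in>I. U i)"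
  shows "1 \<le> (\<Sum>i\<in>I. mass (U i) m v)"
  using assms(1,3)
proof (induction m arbitrary: v)
  case 0
  then obtain i where i: "i \<in> I" "B v \<inter> U i \<noteq> {}" using B_ne[of v] by fastforce
  then have "1 = mass (U i) 0 v" by simp
  also have "\<dots> \<le> (\<Sum>i\<in>I. mass (U i) 0 v)"
    using i assms(2) by (intro member_le_sum mass_nonneg) auto
  finally show ?case .
next
  case (Suc m)
  have "(\<Sum>i\<in>I. mass (U i) (Suc m) v) = (\<Sum>c\<in>ch v. \<Sum>i\<in>I. mass (U i) m c) / card (ch v)"
    by (subst sum.swap) (simp add: sum_divide_distrib[symmetric])
  moreover have "(\<Sum>c\<in>ch v. 1) \<le> (\<Sum>c\<in>ch v. \<Sum>i\<in>I. mass (U i) m c)"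
    using Suc.prems ch_sub by (intro sum_mono Suc.IH) auto
  ultimately show ?case
    using card_ch_pos[OF Suc.prems(1)] by (simp only: le_divide_eq) simp
qed

lemma limit_set_finite_cover:
  assumes v: "v \<in> V" and op: "\<And>i::nat. open (O' i)" and cov: "limit_set v \<subseteq> (\<Union>i. O' i)"
  obtains I m where "finite I" "\<And>m'. m \<le> m' \<Longrightarrow> level_set m' v \<subseteq> (\<Union>i\<in>I. O' i)"
proof -
  have "\<exists>m. level_set m v \<subseteq> (\<Union>i. O' i)"
  proof (rule ccontr)
    assume *: "\<not> ?thesis"
    have "(\<Inter>m. level_set m v - (\<Union>i. O' i)) \<noteq> {}"
    proof (rule compact_nest)
      show "compact (level_set m v - (\<Union>i. O' i))" for m
        using op by (intro compact_diff level_set_compact v) auto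
      show "level_set m v - (\<Union>i. O' i) \<noteq> {}" for m using * by auto
      show "level_set n v - (\<Union>i. O' i) \<subseteq> level_set m v - (\<Union>i. O' i)" if "m \<le> n" for m n
        using level_set_antimono[OF v that] by auto
    qed
    then show False using cov unfolding limit_set_def by auto
  qed
  then obtain m where m: "level_set m v \<subseteq> (\<Union>i. O' i)" by auto
  then obtain I where "finite I" "level_set m v \<subseteq> (\<Union>i\<in>I. O' i)"
    using compactE_image[OF level_set_compact[OF v], of UNIV O' m] op by auto
  then show ?thesis using level_set_antimono[OF v] by (intro that[of I m]) blast+
qed

text \<open>
  The mass distribution principle. The covering sets are enlarged a little, both to make them open
  and to give them positive diameters, to which \<open>mass_le_powr\<close> applies.
\<close>

lemma limit_set_content:
  assumes v: "v \<in> V" and U: "U \<in> hausdorff_covers \<delta> (limit_set v)"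
  shows "ennreal (\<rho> v powr t / (2 * C)) \<le> (\<Sum>i. hausdorff_weight t (U i))"
proof -
  define \<kappa> where "\<kappa> = \<rho> v powr t / (2 * C)"
  have \<kappa>: "0 < \<kappa>" using \<rho>_pos[OF v] C_ge1 by (simp add: \<kappa>_def)
  have diam0: "0 \<le> diameter (U i)" for i
    using U by (intro diameter_ge_0) (auto simp: hausdorff_covers_def)
  have "\<exists>\<epsilon>>0. (diameter (U i) + 2 * \<epsilon>) powr t < diameter (U i) powr t + \<kappa> * (1/2) ^ Suc i" for i
  proof -
    have "((\<lambda>x. (diameter (U i) + 2 * x) powr t) \<longlongrightarrow> (diameter (U i) + 2 * 0) powr t) (at_right 0)"
      using diam0[of i] t_pos
      by (intro tendsto_powr2 tendsto_intros) (auto simp: eventually_at_right_less eventually_at_filter)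
    then have "\<forall>\<^sub>F x in at_right 0. (diameter (U i) + 2 * x) powr t < diameter (U i) powr t + \<kappa> * (1/2) ^ Suc i"
      by (rule order_tendstoD(2)) (use \<kappa> in simp)
    then have "\<forall>\<^sub>F x in at_right 0. x > 0 \<and> (diameter (U i) + 2 * x) powr t < diameter (U i) powr t + \<kappa> * (1/2) ^ Suc i"
      using eventually_at_right_less[of 0] by eventually_elim auto
    then show ?thesis using eventually_happens'[OF trivial_limit_at_right_real] by blast
  qed
  then obtain \<epsilon> where \<epsilon>: "\<And>i. 0 < \<epsilon> i"
    "\<And>i. (diameter (U i) + 2 * \<epsilon> i) powr t < diameter (U i) powr t + \<kappa> * (1/2) ^ Suc i" by metis
  define O' where "O' = (\<lambda>i. \<Union>x\<in>U i. ball x (\<epsilon> i))"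
  define d where "d = (\<lambda>i. diameter (U i) + 2 * \<epsilon> i)"
  have d_pos: "0 < d i" for i using diam0[of i] \<epsilon>(1)[of i] by (simp add: d_def)
  have dist_O: "dist x y \<le> d i" if xy: "x \<in> O' i" "y \<in> O' i" for i x y
  proof -
    obtain x' y' where *: "x' \<in> U i" "y' \<in> U i" "dist x' x < \<epsilon> i" "dist y' y < \<epsilon> i"
      using xy by (auto simp: O'_def)
    have "dist x' y' \<le> diameter (U i)"
      using U * by (intro diameter_bounded_bound) (auto simp: hausdorff_covers_def)
    then show ?thesis
      using * dist_triangle[of x y x'] dist_triangle[of x' y y'] by (simp add: d_def dist_commute)
  qed
  have cov: "limit_set v \<subseteq> (\<Union>i. O' i)"
  proof -
    have "U i \<subseteq> O' i" for i using \<epsilon>(1)[of i] unfolding O'_def by (meson UN_I centre_in_ball subsetI)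
    then have "(\<Union>i. U i) \<subseteq> (\<Union>i. O' i)" by (intro UN_mono order_refl)
    moreover have "limit_set v \<subseteq> (\<Union>i. U i)" using U by (simp add: hausdorff_covers_def)
    ultimately show ?thesis by (rule subset_trans[rotated])
  qed
  have op: "open (O' i)" for i by (auto simp: O'_def)
  obtain I m0 where I: "finite I" "\<And>m'. m0 \<le> m' \<Longrightarrow> level_set m' v \<subseteq> (\<Union>i\<in>I. O' i)"
    by (rule limit_set_finite_cover[OF v op cov]) (rule that)
  \<comment> \<open>For exponent \<open>t > 0\<close> the weight agrees with the power of the diameter, and an empty set stays empty when enlarged, so it can be dropped.\<close>
  define I' where "I' = {i \<in> I. U i \<noteq> {}}"
  have I': "finite I'" "\<And>m'. m0 \<le> m' \<Longrightarrow> level_set m' v \<subseteq> (\<Union>i\<in>I'. O' i)"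
  proof -
    have "(\<Union>i\<in>I. O' i) = (\<Union>i\<in>I'. O' i)" unfolding I'_def O'_def by blast
    then show "\<And>m'. m0 \<le> m' \<Longrightarrow> level_set m' v \<subseteq> (\<Union>i\<in>I'. O' i)" using I by metis
    show "finite I'" using I by (simp add: I'_def)
  qed
  have "\<exists>m\<ge>m0. \<forall>i\<in>I'. \<rho> v \<le> 2 ^ m * d i"
  proof -
    have "\<forall>\<^sub>F m in sequentially. \<rho> v \<le> 2 ^ m * d i" for i
    proof -
      have "filterlim (\<lambda>m. 2 ^ m * d i) at_top sequentially"
        using d_pos[of i] by real_asymp
      then show ?thesis by (auto simp: filterlim_at_top)
    qed
    then have ev: "\<forall>\<^sub>F m in sequentially. \<forall>i\<in>I'. \<rho> v \<le> 2 ^ m * d i"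
      using I'(1) by (simp add: eventually_ball_finite)
    show ?thesis
      using eventually_happens'[OF _ eventually_conj[OF eventually_ge_at_top[of m0] ev]] by auto
  qed
  then obtain m where m: "m0 \<le> m" "\<And>i. i \<in> I' \<Longrightarrow> \<rho> v \<le> 2 ^ m * d i" by auto
  have "1 \<le> (\<Sum>i\<in>I'. mass (O' i) m v)" by (intro mass_cover v I' m)
  also have "\<dots> \<le> (\<Sum>i\<in>I'. C * (d i / \<rho> v) powr t)"
    using dist_O d_pos m by (intro sum_mono mass_le_powr v) auto
  also have "\<dots> = (\<Sum>i\<in>I'. d i powr t) / (2 * \<kappa>)"
  proof -
    have "C * (d i / \<rho> v) powr t = d i powr t / (2 * \<kappa>)" for i
      using d_pos[of i] \<rho>_pos[OF v] C_ge1 by (simp add: \<kappa>_def powr_divide)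
    then show ?thesis by (simp add: sum_divide_distrib)
  qed
  finally have "2 * \<kappa> \<le> (\<Sum>i\<in>I'. d i powr t)" using \<kappa> by (simp add: field_simps)
  also have "\<dots> \<le> (\<Sum>i\<in>I'. diameter (U i) powr t + \<kappa> * (1/2) ^ Suc i)"
    using \<epsilon>(2) by (intro sum_mono) (auto simp: d_def less_imp_le)
  also have "\<dots> = (\<Sum>i\<in>I'. diameter (U i) powr t) + \<kappa> * (\<Sum>i\<in>I'. (1/2) ^ Suc i)"
    by (simp add: sum.distrib sum_distrib_left)
  also have "\<dots> \<le> (\<Sum>i\<in>I'. diameter (U i) powr t) + \<kappa> * 1"
  proof -
    have "(\<Sum>i\<in>I'. (1/2::real) ^ Suc i) \<le> (\<Sum>i. (1/2) ^ Suc i)"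
      using power_half_series I'(1) by (intro sum_le_suminf) (auto simp: sums_iff)
    then show ?thesis using power_half_series \<kappa> by (intro add_left_mono mult_left_mono) (auto simp: sums_iff)
  qed
  finally have "\<kappa> \<le> (\<Sum>i\<in>I'. diameter (U i) powr t)" by simp
  then have "ennreal \<kappa> \<le> ennreal (\<Sum>i\<in>I'. diameter (U i) powr t)" by (rule ennreal_leI)
  also have "\<dots> = (\<Sum>i\<in>I'. hausdorff_weight t (U i))"
    using t_pos by (subst sum_ennreal[symmetric]) (auto simp: hausdorff_weight_def I'_def intro!: sum.cong)
  also have "\<dots> \<le> (\<Sum>i. hausdorff_weight t (U i))"
    using I'(1) by (intro sum_le_suminf) auto
  finally show ?thesis by (simp add: \<kappa>_def)
qed

lemma hausdorff_measure_limit_set: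
  assumes v: "v \<in> V"
  shows "hausdorff_measure t (limit_set v) \<noteq> 0"
proof -
  have "ennreal (\<rho> v powr t / (2 * C)) \<le> hausdorff_premeasure t 1 (limit_set v)"
    unfolding hausdorff_premeasure_def by (intro INF_greatest limit_set_content v)
  also have "\<dots> \<le> hausdorff_measure t (limit_set v)"
    unfolding hausdorff_measure_def by (rule SUP_upper) simp
  finally show ?thesis using \<rho>_pos[OF v] C_ge1 by (auto simp: divide_le_0_iff)
qed

lemma limit_set_child:
  assumes "v \<in> V" "x \<in> limit_set v"
  shows "\<exists>c\<in>ch v. x \<in> limit_set c"
proof (rule ccontr)
  assume "\<not> ?thesis"
  then obtain m where m: "\<And>c. c \<in> ch v \<Longrightarrow> x \<notin> level_set (m c) c"
    unfolding limit_set_def by (auto) metis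
  define M where "M = Max (m ` ch v)"
  have "x \<in> level_set (Suc M) v" using assms(2) unfolding limit_set_def by blast
  then obtain c where c: "c \<in> ch v" "x \<in> level_set M c" by auto
  have "m c \<le> M" using c ch_fin[OF assms(1)] by (simp add: M_def)
  then have "x \<in> level_set (m c) c"
    using level_set_antimono[of c "m c" M] c ch_sub[OF assms(1)] by blast
  then show False using m c by blast
qed

text \<open>
  Since each node has finitely many children, a point of the limit set can be followed down the tree
  through one path, even if boxes overlap.
\<close>

lemma limit_set_path:
  assumes "v \<in> V" "x \<in> limit_set v"
  obtains f where "f 0 = v" "\<And>k. f k \<in> V" "\<And>k. f (Suc k) \<in> ch (f k)" "\<And>k. x \<in> B (f k)"
proof -
  have "\<exists>f. \<forall>k. ((f k \<in> V \<and> x \<in> limit_set (f k)) \<and> (k = 0 \<longrightarrow> f k = v)) \<and> f (Suc k) \<in> ch (f k)"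
  proof (rule dependent_nat_choice)
    show "\<exists>w. (w \<in> V \<and> x \<in> limit_set w) \<and> (0 = (0::nat) \<longrightarrow> w = v)" using assms by auto
  next
    fix w k assume "(w \<in> V \<and> x \<in> limit_set w) \<and> (k = (0::nat) \<longrightarrow> w = v)"
    then show "\<exists>c. ((c \<in> V \<and> x \<in> limit_set c) \<and> (Suc k = 0 \<longrightarrow> c = v)) \<and> c \<in> ch w"
      using limit_set_child[of w x] ch_sub[of w] by blast
  qed
  then obtain f where f: "\<And>k. f k \<in> V" "\<And>k. x \<in> limit_set (f k)" "f 0 = v" "\<And>k. f (Suc k) \<in> ch (f k)"
    by blast
  have "x \<in> B (f k)" for k using f(2)[of k] unfolding limit_set_def
    by (auto dest: spec[of _ 0])
  then show ?thesis using f that by blast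
qed

end

section \<open>The upper bound\<close>

lemma card_vec_components:
  fixes S :: "'n::finite \<Rightarrow> 'a set"
  shows "card {x :: 'a ^ 'n. \<forall>i. x $ i \<in> S i} = (\<Prod>i\<in>UNIV. card (S i))"
proof -
  have "bij_betw (\<lambda>f. \<chi> i. f i) (Pi\<^sub>E UNIV S) {x :: 'a ^ 'n. \<forall>i. x $ i \<in> S i}"
    by (rule bij_betw_byWitness[where f' = vec_nth]) (auto simp: vec_eq_iff)
  then have "card {x :: 'a ^ 'n. \<forall>i. x $ i \<in> S i} = card (Pi\<^sub>E UNIV S)"
    by (simp add: bij_betw_same_card)
  then show ?thesis by (simp add: card_PiE)
qed

lemma finite_vec_components:
  fixes S :: "'n::finite \<Rightarrow> 'a set"
  assumes "\<And>i. finite (S i)"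
  shows "finite {x :: 'a ^ 'n. \<forall>i. x $ i \<in> S i}"
proof -
  have "{x :: 'a ^ 'n. \<forall>i. x $ i \<in> S i} \<subseteq> (\<lambda>f. \<chi> i. f i) ` Pi\<^sub>E UNIV S"
  proof
    fix x :: "'a ^ 'n" assume "x \<in> {x. \<forall>i. x $ i \<in> S i}"
    then show "x \<in> (\<lambda>f. \<chi> i. f i) ` Pi\<^sub>E UNIV S"
      by (intro image_eqI[of _ _ "vec_nth x"]) auto
  qed
  then show ?thesis
    by (rule finite_subset[OF _ finite_imageI[OF finite_PiE]]) (use assms in auto)
qed

lemma Max_UNIV_less_iff:
  fixes f :: "'n::finite \<Rightarrow> real"
  shows "(MAX i. f i) < c \<longleftrightarrow> (\<forall>i. f i < c)"
  by (subst Max_less_iff) auto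

text \<open>
  All numerators that matter for points of the unit cube when the approximation is better than \<open>1\<close>.
\<close>

definition numerators :: "nat \<Rightarrow> (int ^ 'n::finite) set" where
  "numerators q = {p. \<forall>i. p $ i \<in> {- int q..2 * int q}}"

lemma finite_numerators: "finite (numerators q)"
  unfolding numerators_def by (rule finite_vec_components) simp

lemma card_numerators: "card (numerators q :: (int ^ 'n::finite) set) = (3 * q + 1) ^ CARD('n)"
  unfolding numerators_def by (subst card_vec_components) (simp add: nat_add_distrib nat_mult_distrib)

lemma numerators_near_unit_cube:
  fixes p :: "int ^ 'n::finite" and \<alpha> :: "real ^ 'n"
  assumes "\<And>i. \<alpha> $ i \<in> {0..1}" "1 \<le> q" "\<And>i. \<bar>\<alpha> $ i - of_int (p $ i) / of_nat q\<bar> < c" "c \<le> 1"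
  shows "p \<in> numerators q"
proof -
  have "p $ i \<in> {- int q..2 * int q}" for i
  proof -
    have "-1 \<le> of_int (p $ i) / real q" "of_int (p $ i) / real q \<le> 2"
      using assms(1)[of i] assms(3)[of i] assms(4) by (auto simp: abs_less_iff)
    then have "of_int (- int q) \<le> real_of_int (p $ i)" "real_of_int (p $ i) \<le> of_int (2 * int q)"
      using assms(2) by (auto simp: field_simps)
    then show ?thesis by (simp only: of_int_le_iff atLeastAtMost_iff)
  qed
  then show ?thesis by (simp add: numerators_def)
qed

definition cube_about :: "(nat \<Rightarrow> real) \<Rightarrow> nat \<Rightarrow> int ^ 'n \<Rightarrow> (real ^ 'n::finite) set" where
  "cube_about \<psi> q p = {\<alpha>. \<forall>i. \<bar>\<alpha> $ i - of_int (p $ i) / of_nat q\<bar> < \<psi> q}"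

lemma cube_about_dist:
  fixes x y :: "real ^ 'n::finite"
  assumes "x \<in> cube_about \<psi> q p" "y \<in> cube_about \<psi> q p"
  shows "norm (x - y) \<le> 2 * real CARD('n) * \<psi> q"
proof -
  have "norm (x - y) \<le> (\<Sum>i\<in>UNIV. \<bar>(x - y) $ i\<bar>)" by (rule norm_le_l1_cart)
  also have "\<dots> \<le> (\<Sum>i\<in>(UNIV::'n set). 2 * \<psi> q)"
  proof (rule sum_mono)
    fix i
    have "\<bar>x $ i - of_int (p $ i) / of_nat q\<bar> < \<psi> q" "\<bar>y $ i - of_int (p $ i) / of_nat q\<bar> < \<psi> q"
      using assms by (auto simp: cube_about_def)
    then show "\<bar>(x - y) $ i\<bar> \<le> 2 * \<psi> q" by simp
  qed
  finally show ?thesis by simp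
qed

lemma cube_about_bounded: "bounded (cube_about \<psi> q p :: (real ^ 'n::finite) set)"
  unfolding bounded_two_points
  by (intro exI[of _ "2 * real CARD('n) * \<psi> q"] ballI) (simp add: dist_norm cube_about_dist)

lemma cube_about_diameter:
  "0 \<le> \<psi> q \<Longrightarrow> diameter (cube_about \<psi> q p :: (real ^ 'n::finite) set) \<le> 2 * real CARD('n) * \<psi> q"
  by (intro diameter_le cube_about_dist) auto

lemma well_approximable_in_cubes:
  fixes \<alpha> :: "real ^ 'n::finite"
  assumes \<psi>: "\<And>q. 1 \<le> q \<Longrightarrow> \<psi> q \<le> 1" and \<alpha>: "\<alpha> \<in> well_approximable \<psi>"
  obtains q p where "Q \<le> q" "p \<in> numerators q" "\<alpha> \<in> cube_about \<psi> q p"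
proof -
  define S where "S = {(q :: nat, p :: int ^ 'n).
            1 \<le> q \<and> (MAX i. \<bar>\<alpha> $ i - of_int (p $ i) / of_nat q\<bar>) < \<psi> q}"
  have inf: "infinite S" and cube: "\<And>i. \<alpha> $ i \<in> {0..1}"
    using \<alpha> by (auto simp: well_approximable_def S_def)
  have S: "p \<in> numerators q \<and> \<alpha> \<in> cube_about \<psi> q p" if "(q, p) \<in> S" for q p
    using that numerators_near_unit_cube[of \<alpha> q p "\<psi> q"] cube \<psi>[of q]
    by (auto simp: S_def Max_UNIV_less_iff cube_about_def)
  have "finite (Sigma {..<Q} (numerators :: nat \<Rightarrow> (int ^ 'n) set))"
    by (intro finite_SigmaI finite_numerators) auto
  then have "\<not> S \<subseteq> Sigma {..<Q} numerators" using inf finite_subset by blast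
  then obtain q p where "(q, p) \<in> S" "(q, p) \<notin> Sigma {..<Q} numerators" by auto
  then show ?thesis using S[of q p] that[of q p] by auto
qed

text \<open>
  The cover by all cubes with denominator at least \<open>Q\<close>. Its index encodes a pair of the denominator,
  shifted by \<open>Q\<close>, and the number of the numerator in an enumeration; unused indices give the empty
  set.
\<close>

lemma hausdorff_premeasure_well_approximable_le:
  fixes \<psi> :: "nat \<Rightarrow> real" and u \<delta> :: real
  assumes \<psi>: "\<And>q. 1 \<le> q \<Longrightarrow> \<psi> q \<in> {0<..1}" and u: "0 < u" and \<delta>: "0 < \<delta>" and Q: "1 \<le> Q"
    and small: "\<And>q. Q \<le> q \<Longrightarrow> 2 * real CARD('n) * \<psi> q \<le> \<delta>"
  shows "hausdorff_premeasure u \<delta> (well_approximable \<psi> :: (real ^ 'n::finite) set) \<le>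
    (\<Sum>q. ennreal (real ((3 * (q + Q) + 1) ^ CARD('n)) * (2 * real CARD('n) * \<psi> (q + Q)) powr u))"
proof -
  have "\<exists>h. bij_betw h {0..<card (numerators q :: (int ^ 'n) set)} (numerators q :: (int ^ 'n) set)" for q
    by (rule ex_bij_betw_nat_finite) (rule finite_numerators)
  then obtain h :: "nat \<Rightarrow> nat \<Rightarrow> int ^ 'n"
    where h: "\<And>q. bij_betw (h q) {0..<card (numerators q :: (int ^ 'n) set)} (numerators q)" by metis
  define V :: "nat \<times> nat \<Rightarrow> (real ^ 'n) set" where
    "V = (\<lambda>(q, j). if j < card (numerators (q + Q) :: (int ^ 'n) set) then cube_about \<psi> (q + Q) (h (q + Q) j) else {})"
  have \<psi>0: "0 < \<psi> q" if "Q \<le> q" for q using \<psi>[of q] that Q by auto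
  have "(\<lambda>i. V (prod_decode i)) \<in> hausdorff_covers \<delta> (well_approximable \<psi>)"
    unfolding hausdorff_covers_def
  proof (intro CollectI conjI allI subsetI)
    fix \<alpha> :: "real ^ 'n" assume "\<alpha> \<in> well_approximable \<psi>"
    then obtain q p where qp: "Q \<le> q" "p \<in> numerators q" "\<alpha> \<in> cube_about \<psi> q p"
      using well_approximable_in_cubes[of \<psi> \<alpha> Q] \<psi> by auto
    then obtain j where "j < card (numerators q :: (int ^ 'n) set)" "p = h q j"
      using h[of q] unfolding bij_betw_def by force
    then have "\<alpha> \<in> V (q - Q, j)" using qp by (simp add: V_def)
    then have "\<alpha> \<in> V (prod_decode (prod_encode (q - Q, j)))" by simp
    then show "\<alpha> \<in> (\<Union>i. V (prod_decode i))" by blast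
  next
    fix i
    show "bounded (V (prod_decode i))"
      by (auto simp: V_def cube_about_bounded split: prod.split)
    obtain q j where qj: "prod_decode i = (q, j)" by fastforce
    have "diameter (cube_about \<psi> (q + Q) (h (q + Q) j)) \<le> \<delta>"
      using cube_about_diameter[of \<psi> "q + Q" "h (q + Q) j"] \<psi>0[of "q + Q"] small[of "q + Q"] by simp
    then show "diameter (V (prod_decode i)) \<le> \<delta>" using \<delta> by (simp add: qj V_def)
  qed
  then have "hausdorff_premeasure u \<delta> (well_approximable \<psi> :: (real ^ 'n) set) \<le>
      (\<Sum>i. hausdorff_weight u (V (prod_decode i)))"
    unfolding hausdorff_premeasure_def by (rule INF_lower)
  also have "\<dots> = (\<Sum>q. \<Sum>j. hausdorff_weight u (V (q, j)))"
    by (rule suminf_ennreal_2dimen) simp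
  also have "\<dots> \<le> (\<Sum>q. ennreal (real ((3 * (q + Q) + 1) ^ CARD('n)) * (2 * real CARD('n) * \<psi> (q + Q)) powr u))"
  proof (intro suminf_le allI)
    fix q
    let ?c = "card (numerators (q + Q) :: (int ^ 'n) set)"
    let ?w = "(2 * real CARD('n) * \<psi> (q + Q)) powr u"
    have "(\<Sum>j. hausdorff_weight u (V (q, j))) = (\<Sum>j<?c. hausdorff_weight u (V (q, j)))"
      by (rule suminf_finite) (auto simp: V_def hausdorff_weight_def)
    also have "\<dots> \<le> (\<Sum>j<?c. ennreal ?w)"
    proof (rule sum_mono)
      fix j
      have "diameter (V (q, j)) powr u \<le> ?w" if "V (q, j) \<noteq> {}"
        using that cube_about_diameter[of \<psi> "q + Q" "h (q + Q) j"] \<psi>0[of "q + Q"] u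
        by (intro powr_mono2 diameter_ge_0) (auto simp: V_def cube_about_bounded split: if_splits)
      then show "hausdorff_weight u (V (q, j)) \<le> ennreal ?w"
        using u by (auto simp: hausdorff_weight_def intro: ennreal_leI)
    qed
    also have "\<dots> = ennreal (real ?c * ?w)"
      by (simp add: ennreal_mult ennreal_of_nat_eq_real_of_nat)
    finally show "(\<Sum>j. hausdorff_weight u (V (q, j)))
      \<le> ennreal (real ((3 * (q + Q) + 1) ^ CARD('n)) * ?w)" by (simp only: card_numerators)
  qed auto
  finally show ?thesis .
qed

lemma eventually_less_powr:
  fixes \<psi> :: "nat \<Rightarrow> real" and mu lam :: real
  assumes "\<And>q. 1 \<le> q \<Longrightarrow> 0 < \<psi> q" "lower_order (\<lambda>q. 1 / \<psi> q) = ereal lam" "mu < lam"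
  shows "\<forall>\<^sub>F q in sequentially. \<psi> q < real q powr - mu"
proof -
  have "ereal mu < liminf (\<lambda>x. ereal (ln (1 / \<psi> x) / ln (real x)))"
    using assms by (simp add: lower_order_def)
  then have "\<forall>\<^sub>F q in sequentially. ereal mu < ereal (ln (1 / \<psi> q) / ln (real q))"
    by (rule less_LiminfD)
  moreover have "\<forall>\<^sub>F q in sequentially. 2 \<le> q" by (rule eventually_ge_at_top)
  ultimately show ?thesis
  proof eventually_elim
    case (elim q)
    have pos: "0 < \<psi> q" "0 < ln (real q)" using assms(1)[of q] elim by auto
    then have "mu * ln (real q) < - ln (\<psi> q)" using elim by (simp add: field_simps ln_div)
    then have "ln (\<psi> q) < ln (real q powr - mu)" using elim by (simp add: ln_powr)
    then show ?case using pos elim by (subst (asm) ln_less_cancel_iff) auto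
  qed
qed

lemma eventually_greater_powr:
  fixes \<psi> :: "nat \<Rightarrow> real" and mu lam :: real
  assumes "\<And>q. 1 \<le> q \<Longrightarrow> 0 < \<psi> q" "upper_order (\<lambda>q. 1 / \<psi> q) = ereal lam" "lam < mu"
  shows "\<forall>\<^sub>F q in sequentially. real q powr - mu < \<psi> q"
proof -
  have "limsup (\<lambda>x. ereal (ln (1 / \<psi> x) / ln (real x))) < ereal mu"
    using assms by (simp add: upper_order_def)
  then have "\<forall>\<^sub>F q in sequentially. ereal (ln (1 / \<psi> q) / ln (real q)) < ereal mu"
    by (rule Limsup_lessD)
  moreover have "\<forall>\<^sub>F q in sequentially. 2 \<le> q" by (rule eventually_ge_at_top)
  ultimately show ?thesis
  proof eventually_elim
    case (elim q)
    have pos: "0 < \<psi> q" "0 < ln (real q)" using assms(1)[of q] elim by auto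
    then have "- ln (\<psi> q) < mu * ln (real q)" using elim by (simp add: field_simps ln_div)
    then have "ln (real q powr - mu) < ln (\<psi> q)" using elim by (simp add: ln_powr)
    then show ?case using pos elim by (subst (asm) ln_less_cancel_iff) auto
  qed
qed

text \<open>
  An exponent \<open>mu < lam\<close> with \<open>mu * u > n + 1\<close> makes the sum over all cubes converge, so its tails
  tend to \<open>0\<close>.
\<close>

lemma hausdorff_measure_well_approximable_eq_0:
  fixes \<psi> :: "nat \<Rightarrow> real" and u lam :: real
  assumes \<psi>: "\<And>q. 1 \<le> q \<Longrightarrow> \<psi> q \<in> {0<..1}" and lo: "lower_order (\<lambda>q. 1 / \<psi> q) = ereal lam"
    and lam: "0 < lam" and u: "(real CARD('n) + 1) / lam < u"
  shows "hausdorff_measure u (well_approximable \<psi> :: (real ^ 'n::finite) set) = 0"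
proof -
  let ?n = "real CARD('n)"
  have u0: "0 < u" using u lam by (smt (verit) divide_nonneg_pos of_nat_0_le_iff)
  have less: "(?n + 1) / u < lam" using u u0 lam by (simp add: field_simps)
  then obtain mu where mu: "mu < lam" "(?n + 1) / u < mu" using dense by blast
  have mu0: "0 < mu" using mu(2) u0 by (smt (verit) divide_nonneg_pos of_nat_0_le_iff)
  have e: "?n - mu * u < -1" using mu(2) u0 by (simp add: field_simps)
  define K where "K = 4 ^ CARD('n) * (2 * ?n) powr u"
  have ev: "\<forall>\<^sub>F q in sequentially. \<psi> q < real q powr - mu"
    by (rule eventually_less_powr[OF _ lo mu(1)]) (use \<psi> in auto)
  define g where "g = (\<lambda>q::nat. K * real q powr (?n - mu * u))"
  have summable_g: "summable g"
    unfolding g_def by (intro summable_mult) (use e in \<open>simp add: summable_real_powr_iff\<close>)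
  have "hausdorff_premeasure u \<delta> (well_approximable \<psi> :: (real ^ 'n) set) \<le> 0" if \<delta>: "0 < \<delta>" for \<delta>
  proof (rule ennreal_le_epsilon)
    fix \<epsilon> :: real assume \<epsilon>: "0 < \<epsilon>"
    have "((\<lambda>q::nat. 2 * ?n * real q powr - mu) \<longlongrightarrow> 0) sequentially" using mu0 by real_asymp
    then have "\<forall>\<^sub>F q in sequentially. 2 * ?n * real q powr - mu < \<delta>" using \<delta> by (rule order_tendstoD)
    then have "\<forall>\<^sub>F q in sequentially. 2 * ?n * \<psi> q \<le> \<delta>"
      using ev
    proof eventually_elim
      case (elim q)
      have "2 * ?n * \<psi> q \<le> 2 * ?n * real q powr - mu" using elim by (intro mult_left_mono) auto
      then show ?case using elim(1) by linarith
    qed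
    then obtain Q1 where Q1: "\<And>q. Q1 \<le> q \<Longrightarrow> 2 * ?n * \<psi> q \<le> \<delta>" by (auto simp: eventually_sequentially)
    obtain Q2 where Q2: "\<And>q. Q2 \<le> q \<Longrightarrow> \<psi> q < real q powr - mu" using ev by (auto simp: eventually_sequentially)
    obtain Q3 where Q3: "\<And>q. Q3 \<le> q \<Longrightarrow> norm (\<Sum>i. g (i + q)) < \<epsilon>"
      using suminf_exist_split[OF \<epsilon> summable_g] by auto
    define Q where "Q = Max {1, Q1, Q2, Q3}"
    have Q: "1 \<le> Q" "Q1 \<le> Q" "Q2 \<le> Q" "Q3 \<le> Q" by (auto simp: Q_def)
    have summand: "real ((3 * q + 1) ^ CARD('n)) * (2 * ?n * \<psi> q) powr u \<le> g q" if q: "Q \<le> q" for q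
    proof -
      have q1: "1 \<le> q" and \<psi>q: "0 < \<psi> q" using q Q \<psi>[of q] by auto
      have "real ((3 * q + 1) ^ CARD('n)) \<le> (4 * real q) ^ CARD('n)"
        unfolding of_nat_power using q1 by (intro power_mono) auto
      also have "\<dots> = 4 ^ CARD('n) * real q powr ?n" using q1 by (simp add: power_mult_distrib powr_realpow)
      finally have 1: "real ((3 * q + 1) ^ CARD('n)) \<le> 4 ^ CARD('n) * real q powr ?n" .
      have "(2 * ?n * \<psi> q) powr u \<le> (2 * ?n * real q powr - mu) powr u"
        using Q2[of q] q Q \<psi>q u0 by (intro powr_mono2 mult_left_mono) auto
      also have "\<dots> = (2 * ?n) powr u * real q powr (- mu * u)"
        by (simp add: powr_mult powr_powr)
      finally have 2: "(2 * ?n * \<psi> q) powr u \<le> (2 * ?n) powr u * real q powr (- mu * u)" .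
      have "real ((3 * q + 1) ^ CARD('n)) * (2 * ?n * \<psi> q) powr u \<le>
          (4 ^ CARD('n) * real q powr ?n) * ((2 * ?n) powr u * real q powr (- mu * u))"
        using 1 2 by (intro mult_mono) auto
      also have "\<dots> = K * (real q powr ?n * real q powr (- mu * u))" by (simp add: K_def)
      also have "real q powr ?n * real q powr (- mu * u) = real q powr (?n - mu * u)"
        by (simp flip: powr_add)
      finally show ?thesis by (simp add: g_def)
    qed
    have "hausdorff_premeasure u \<delta> (well_approximable \<psi> :: (real ^ 'n) set) \<le>
      (\<Sum>q. ennreal (real ((3 * (q + Q) + 1) ^ CARD('n)) * (2 * real CARD('n) * \<psi> (q + Q)) powr u))"
      using Q1 Q by (intro hausdorff_premeasure_well_approximable_le \<psi> u0 \<delta>) auto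
    also have "\<dots> \<le> (\<Sum>q. ennreal (g (q + Q)))"
      by (intro suminf_le ennreal_leI summand) auto
    also have "\<dots> = ennreal (\<Sum>q. g (q + Q))"
    proof (rule suminf_ennreal2)
      show "summable (\<lambda>q. g (q + Q))" using summable_g by (subst summable_iff_shift)
    qed (simp add: g_def K_def)
    also have "\<dots> \<le> ennreal \<epsilon>"
      using Q3[of Q] Q by (intro ennreal_leI) auto
    finally show "hausdorff_premeasure u \<delta> (well_approximable \<psi> :: (real ^ 'n) set) \<le> 0 + ennreal \<epsilon>" by simp
  qed
  then show ?thesis unfolding hausdorff_measure_def by (intro antisym SUP_least) auto
qed

lemma hausdorff_dim_well_approximable_le:
  fixes \<psi> :: "nat \<Rightarrow> real" and lam :: real
  assumes "\<And>q. 1 \<le> q \<Longrightarrow> \<psi> q \<in> {0<..1}" "lower_order (\<lambda>q. 1 / \<psi> q) = ereal lam" "0 < lam"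
  shows "hausdorff_dim (well_approximable \<psi> :: (real ^ 'n::finite) set) \<le> ereal ((real CARD('n) + 1) / lam)"
  using assms by (intro hausdorff_dim_leI hausdorff_measure_well_approximable_eq_0) auto

section \<open>Reduced fractions with badly approximable surroundings\<close>

lemma fraction_gap:
  fixes r r' :: int and s s' :: nat
  assumes "1 \<le> s" "1 \<le> s'" "of_int r / of_nat s \<noteq> (of_int r' / of_nat s' :: real)"
  shows "1 / (real s * real s') \<le> \<bar>of_int r / of_nat s - of_int r' / of_nat s'\<bar>"
proof -
  have "r * int s' - r' * int s \<noteq> 0"
  proof
    assume "r * int s' - r' * int s = 0"
    then have "real_of_int (r * int s') = real_of_int (r' * int s)" by simp
    then show False using assms by (simp add: field_simps)
  qed
  then have "1 \<le> \<bar>r * int s' - r' * int s\<bar>" by linarith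
  then have "(1::real) \<le> \<bar>of_int (r * int s' - r' * int s)\<bar>"
    by (metis of_int_1_le_iff of_int_abs)
  moreover have "of_int r / of_nat s - of_int r' / of_nat s' =
      (of_int (r * int s' - r' * int s) :: real) / (real s * real s')"
    using assms by (simp add: field_simps)
  ultimately show ?thesis using assms by (simp add: abs_mult divide_right_mono)
qed

lemma coprime_fraction_neq:
  fixes r r' :: int and s s' :: nat
  assumes "coprime r (int s)" "1 \<le> s'" "s' < s"
  shows "of_int r / of_nat s \<noteq> (of_int r' / of_nat s' :: real)"
proof
  assume "of_int r / of_nat s = (of_int r' / of_nat s' :: real)"
  then have "real_of_int (r * int s') = real_of_int (r' * int s)"
    using assms by (simp add: field_simps)
  then have "r * int s' = r' * int s" by linarith
  then have "int s dvd r * int s'" by simp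
  then have "int s dvd int s'" using assms(1) by (simp add: coprime_dvd_mult_right_iff coprime_commute)
  then show False using assms by (auto dest: zdvd_imp_le)
qed

lemma few_children_near_point:
  fixes a \<rho> \<delta> :: real
  assumes "0 < \<delta>"
  shows "card {i::nat. i < b \<and> (\<exists>x\<in>{a + real i * \<delta>..a + (real i + 1) * \<delta>}. \<bar>x - \<rho>\<bar> < \<delta> / 2)} \<le> 3"
proof -
  \<comment> \<open>A part that comes within \<open>\<delta> / 2\<close> of \<open>\<rho>\<close> starts strictly between \<open>y\<close> and \<open>y + 2\<close>, in units of \<open>\<delta>\<close> from \<open>a\<close>.\<close>
  define y where "y = (\<rho> - a) / \<delta> - 3/2"
  have "i \<in> nat ` {\<lfloor>y\<rfloor>..\<lfloor>y\<rfloor> + 2}"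
    if "x \<in> {a + real i * \<delta>..a + (real i + 1) * \<delta>}" "\<bar>x - \<rho>\<bar> < \<delta> / 2" for i x
  proof -
    have "real i * \<delta> < \<rho> - a + \<delta> / 2" "\<rho> - a - 3 / 2 * \<delta> < real i * \<delta>"
      using that by (simp_all only: atLeastAtMost_iff distrib_right) linarith+
    then have "real i < (\<rho> - a) / \<delta> + 1/2" "(\<rho> - a) / \<delta> - 3/2 < real i"
      using assms by (auto simp: field_simps)
    then have "real i < y + 2" "y < real i" by (auto simp: y_def)
    then have "int i \<in> {\<lfloor>y\<rfloor>..\<lfloor>y\<rfloor> + 2}" by simp linarith
    then show ?thesis by (metis image_eqI nat_int)
  qed
  then have "{i::nat. i < b \<and> (\<exists>x\<in>{a + real i * \<delta>..a + (real i + 1) * \<delta>}. \<bar>x - \<rho>\<bar> < \<delta> / 2)} \<subseteq> nat ` {\<lfloor>y\<rfloor>..\<lfloor>y\<rfloor> + 2}"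
    by blast
  then have "card {i::nat. i < b \<and> (\<exists>x\<in>{a + real i * \<delta>..a + (real i + 1) * \<delta>}. \<bar>x - \<rho>\<bar> < \<delta> / 2)} \<le> card (nat ` {\<lfloor>y\<rfloor>..\<lfloor>y\<rfloor> + 2})"
    by (intro card_mono) auto
  also have "\<dots> \<le> card {\<lfloor>y\<rfloor>..\<lfloor>y\<rfloor> + 2}" by (rule card_image_le) simp
  finally show ?thesis by simp
qed

text \<open>
  Two different fractions with denominators below \<open>1 / sqrt (2 \<delta>)\<close> are more than \<open>2 \<delta>\<close> apart, which
  is too far for both to be near an interval of length \<open>\<delta>\<close>.
\<close>

lemma unique_fraction_near_interval:
  fixes r r' :: int and s s' b :: nat and a \<delta> :: real
  assumes "0 < \<delta>" "2 \<le> b" "1 \<le> s" "1 \<le> s'" "2 * \<delta> * real s ^ 2 < 1" "2 * \<delta> * real s' ^ 2 < 1"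
    and "x \<in> {a..a + \<delta>}" "x' \<in> {a..a + \<delta>}"
    and "\<bar>x - of_int r / of_nat s\<bar> < \<delta> / (2 * b)" "\<bar>x' - of_int r' / of_nat s'\<bar> < \<delta> / (2 * b)"
  shows "of_int r / of_nat s = (of_int r' / of_nat s' :: real)"
proof (rule ccontr)
  assume ne: "\<not> ?thesis"
  have "\<delta> / (2 * b) \<le> \<delta> / 4" using assms(1,2) by (intro divide_left_mono) auto
  then have "\<bar>of_int r / of_nat s - (of_int r' / of_nat s' :: real)\<bar> < 2 * \<delta>"
    using assms by (auto simp: abs_less_iff)
  then have "1 / (real s * real s') < 2 * \<delta>"
    using fraction_gap[OF assms(3,4) ne] by linarith
  then have "1 < 2 * \<delta> * (real s * real s')" using assms(3,4) by (simp add: field_simps)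
  also have "2 * \<delta> * (real s * real s') \<le> 2 * \<delta> * ((real s ^ 2 + real s' ^ 2) / 2)"
    using assms(1) sum_squares_bound[of "real s" "real s'"]
    by (intro mult_left_mono) (auto simp: power2_eq_square)
  also have "\<dots> \<le> 1" using assms(5,6) by (simp add: algebra_simps)
  finally show False by simp
qed

text \<open>
  One step of Jarnik's construction. In the range of denominators considered, the zone of radius
  \<open>1 / (4 b\<^sup>2 s\<^sup>2)\<close> about a fraction is at most half as wide, on each side, as a part of the
  subdivision. Hence the zones of the only fraction that matters meet at most three of the \<open>b\<close> parts.
\<close>

lemma badly_approximable_children:
  fixes a \<delta> :: real and b :: nat
  assumes l: "0 < \<delta>" and b: "4 \<le> b"
  obtains G where "G \<subseteq> {..<b}" "b - 3 \<le> card G"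
    "\<And>i x r s. i \<in> G \<Longrightarrow> x \<in> {a + real i * (\<delta> / b)..a + (real i + 1) * (\<delta> / b)} \<Longrightarrow>
       1 \<le> 2 * b * \<delta> * real s ^ 2 \<Longrightarrow> 2 * \<delta> * real s ^ 2 < 1 \<Longrightarrow>
       1 / (4 * real b ^ 2 * real s ^ 2) \<le> \<bar>x - of_int r / of_nat s\<bar>"
proof -
  define near where "near = (\<lambda>\<rho>. \<exists>(r::int) s::nat. \<rho> = of_int r / of_nat s \<and> 1 \<le> s \<and> 2 * \<delta> * real s ^ 2 < 1 \<and>
      (\<exists>x\<in>{a..a + \<delta>}. \<bar>x - \<rho>\<bar> < \<delta> / (2 * b)))"
  obtain \<rho> :: real where uniq: "\<And>\<rho>'. near \<rho>' \<Longrightarrow> \<rho>' = \<rho>"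
  proof -
    have "\<rho>1 = \<rho>2" if n: "near \<rho>1" "near \<rho>2" for \<rho>1 \<rho>2
    proof -
      from n(1) obtain r s x where 1: "\<rho>1 = of_int r / of_nat s" "1 \<le> s" "2 * \<delta> * real s ^ 2 < 1"
        "x \<in> {a..a + \<delta>}" "\<bar>x - \<rho>1\<bar> < \<delta> / (2 * b)" unfolding near_def by blast
      from n(2) obtain r' s' x' where 2: "\<rho>2 = of_int r' / of_nat s'" "1 \<le> s'" "2 * \<delta> * real s' ^ 2 < 1"
        "x' \<in> {a..a + \<delta>}" "\<bar>x' - \<rho>2\<bar> < \<delta> / (2 * b)" unfolding near_def by blast
      show ?thesis
        using unique_fraction_near_interval[OF l _ 1(2) 2(2) 1(3) 2(3) 1(4) 2(4) 1(5)[unfolded 1(1)] 2(5)[unfolded 2(1)]]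
          1(1) 2(1) b by simp
    qed
    then show ?thesis using that by metis
  qed
  define G where "G = {i. i < b \<and> (\<forall>x\<in>{a + real i * (\<delta> / b)..a + (real i + 1) * (\<delta> / b)}. \<delta> / b / 2 \<le> \<bar>x - \<rho>\<bar>)}"
  show ?thesis
  proof
    show "G \<subseteq> {..<b}" by (auto simp: G_def)
    have "b = card {..<b}" by simp
    also have "{..<b} = G \<union> {i. i < b \<and> (\<exists>x\<in>{a + real i * (\<delta> / b)..a + (real i + 1) * (\<delta> / b)}. \<bar>x - \<rho>\<bar> < \<delta> / b / 2)}"
      by (auto simp: G_def not_le)
    also have "card \<dots> \<le> card G + 3"
      using few_children_near_point[of "\<delta> / b" b a \<rho>] l b
      by (intro order.trans[OF card_Un_le] add_left_mono) auto
    finally show "b - 3 \<le> card G" by simp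
  next
    fix i x s and r :: int
    assume i: "i \<in> G" and x: "x \<in> {a + real i * (\<delta> / b)..a + (real i + 1) * (\<delta> / b)}"
      and s1: "1 \<le> 2 * b * \<delta> * real s ^ 2" and s2: "2 * \<delta> * real s ^ 2 < 1"
    have s: "1 \<le> s" using s1 by (cases s) auto
    show "1 / (4 * real b ^ 2 * real s ^ 2) \<le> \<bar>x - of_int r / of_nat s\<bar>"
    proof (rule ccontr)
      assume "\<not> ?thesis"
      moreover have "1 / (4 * real b ^ 2 * real s ^ 2) \<le> \<delta> / (2 * b)"
        using s1 s b l by (simp add: field_simps power2_eq_square)
      ultimately have lt: "\<bar>x - of_int r / of_nat s\<bar> < \<delta> / (2 * b)" by linarith
      have "x \<in> {a..a + \<delta>}"
      proof -
        have "0 \<le> real i * (\<delta> / b)" using l by simp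
        moreover have "(real i + 1) * (\<delta> / b) \<le> real b * (\<delta> / b)"
          using i l by (intro mult_right_mono) (auto simp: G_def)
        ultimately show ?thesis using x b by simp
      qed
      then have "near (of_int r / of_nat s)" unfolding near_def using lt s s2 by blast
      then have "of_int r / of_nat s = \<rho>" by (rule uniq)
      then have "\<delta> / b / 2 \<le> \<bar>x - of_int r / of_nat s\<bar>" using i x by (auto simp: G_def)
      then show False using lt by simp
    qed
  qed
qed

text \<open>
  The left end points of the intervals that survive \<open>j\<close> steps. Step \<open>i\<close> takes care of the denominators
  \<open>s\<close> for which \<open>2 b s\<^sup>2\<close> lies between the inverse lengths of the intervals at depth \<open>i\<close> and \<open>i + 1\<close>,
  so that all steps together cover the range stated.
\<close>

lemma badly_approximable_tree:
  fixes x0 L :: real and b :: nat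
  assumes L: "0 < L" and b: "4 \<le> b"
  shows "\<exists>A. finite A \<and> (b - 3) ^ j \<le> card A \<and> A \<subseteq> {x0..x0 + L - L / b ^ j} \<and>
    (\<forall>a\<in>A. \<forall>a'\<in>A. a \<noteq> a' \<longrightarrow> L / b ^ j \<le> \<bar>a - a'\<bar>) \<and>
    (\<forall>a\<in>A. \<forall>x\<in>{a..a + L / b ^ j}. \<forall>(r::int) s::nat.
      1 \<le> 2 * b * L * real s ^ 2 \<longrightarrow> 2 * b * (L / b ^ j) * real s ^ 2 < 1 \<longrightarrow>
      1 / (4 * real b ^ 2 * real s ^ 2) \<le> \<bar>x - of_int r / of_nat s\<bar>)"
proof (induction j)
  case 0
  show ?case by (intro exI[of _ "{x0}"]) auto
next
  case (Suc j)
  define \<delta> where "\<delta> = L / b ^ j"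
  have l: "0 < \<delta>" using L b by (simp add: \<delta>_def)
  have l': "L / b ^ Suc j = \<delta> / b" by (simp add: \<delta>_def)
  from Suc[folded \<delta>_def] obtain A where A: "finite A" "(b - 3) ^ j \<le> card A"
    "A \<subseteq> {x0..x0 + L - \<delta>}" "\<And>a a'. a \<in> A \<Longrightarrow> a' \<in> A \<Longrightarrow> a \<noteq> a' \<Longrightarrow> \<delta> \<le> \<bar>a - a'\<bar>"
    "\<And>a x r s. a \<in> A \<Longrightarrow> x \<in> {a..a + \<delta>} \<Longrightarrow> 1 \<le> 2 * b * L * real s ^ 2 \<Longrightarrow> 2 * b * \<delta> * real s ^ 2 < 1 \<Longrightarrow>
      1 / (4 * real b ^ 2 * real s ^ 2) \<le> \<bar>x - of_int r / of_nat s\<bar>" by blast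
  have "\<exists>G. G \<subseteq> {..<b} \<and> b - 3 \<le> card G \<and>
    (\<forall>i\<in>G. \<forall>x\<in>{a + real i * (\<delta> / b)..a + (real i + 1) * (\<delta> / b)}. \<forall>(r::int) s::nat.
       1 \<le> 2 * b * \<delta> * real s ^ 2 \<longrightarrow> 2 * \<delta> * real s ^ 2 < 1 \<longrightarrow>
       1 / (4 * real b ^ 2 * real s ^ 2) \<le> \<bar>x - of_int r / of_nat s\<bar>)" for a
    by (rule badly_approximable_children[OF l b, of a]) blast
  then obtain G where G: "\<And>a. G a \<subseteq> {..<b}" "\<And>a. b - 3 \<le> card (G a)"
    "\<And>a i x r s. i \<in> G a \<Longrightarrow> x \<in> {a + real i * (\<delta> / b)..a + (real i + 1) * (\<delta> / b)} \<Longrightarrow>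
       1 \<le> 2 * b * \<delta> * real s ^ 2 \<Longrightarrow> 2 * \<delta> * real s ^ 2 < 1 \<Longrightarrow>
       1 / (4 * real b ^ 2 * real s ^ 2) \<le> \<bar>x - of_int r / of_nat s\<bar>" by metis
  have finG: "finite (G a)" for a using G(1) by (rule finite_subset) simp
  define f where "f = (\<lambda>(a, i::nat). a + real i * (\<delta> / b))"
  have off: "0 \<le> real i * (\<delta> / b)" "real i * (\<delta> / b) \<le> \<delta> - \<delta> / b" if "i \<in> G a" for a i
  proof -
    show "0 \<le> real i * (\<delta> / b)" using l by simp
    have "(real i + 1) * (\<delta> / b) \<le> real b * (\<delta> / b)"
      using that G(1)[of a] l by (intro mult_right_mono) auto
    then show "real i * (\<delta> / b) \<le> \<delta> - \<delta> / b" using b by (simp add: field_simps)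
  qed
  have sep: "\<delta> / b \<le> \<bar>f (a, i) - f (a', i')\<bar>"
    if "a \<in> A" "i \<in> G a" "a' \<in> A" "i' \<in> G a'" "(a, i) \<noteq> (a', i')" for a i a' i'
  proof (cases "a = a'")
    case True
    then have "1 \<le> \<bar>real i - real i'\<bar>" using that by auto
    then have "1 * (\<delta> / b) \<le> \<bar>real i - real i'\<bar> * (\<delta> / b)" using l by (intro mult_right_mono) auto
    also have "\<dots> = \<bar>(real i - real i') * (\<delta> / b)\<bar>" using l by (simp add: abs_mult)
    finally show ?thesis using True by (simp add: f_def algebra_simps diff_divide_distrib)
  next
    case False
    then have "\<delta> \<le> \<bar>a - a'\<bar>" using A(4) that by blast
    then show ?thesis using off[OF that(2)] off[OF that(4)] by (auto simp: f_def)
  qed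
  have inj: "inj_on f (Sigma A G)"
  proof (rule inj_onI)
    fix u v assume "u \<in> Sigma A G" "v \<in> Sigma A G" "f u = f v"
    moreover have "0 < \<delta> / b" using l b by simp
    ultimately show "u = v" using sep[of "fst u" "snd u" "fst v" "snd v"] by fastforce
  qed
  have card: "(b - 3) ^ Suc j \<le> card (f ` Sigma A G)"
  proof -
    have "(b - 3) ^ Suc j \<le> card A * (b - 3)" using A(2) by (simp add: mult.commute)
    also have "\<dots> = (\<Sum>a\<in>A. b - 3)" by simp
    also have "\<dots> \<le> (\<Sum>a\<in>A. card (G a))" using G(2) by (intro sum_mono)
    also have "\<dots> = card (Sigma A G)" using A(1) finG by simp
    also have "\<dots> = card (f ` Sigma A G)" using inj by (simp add: card_image)
    finally show ?thesis .
  qed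
  have sub: "f ` Sigma A G \<subseteq> {x0..x0 + L - \<delta> / b}"
  proof
    fix y assume "y \<in> f ` Sigma A G"
    then obtain a i where "a \<in> A" "i \<in> G a" "y = f (a, i)" by auto
    then show "y \<in> {x0..x0 + L - \<delta> / b}" using A(3) off[of i a] by (fastforce simp: f_def)
  qed
  have apart: "1 / (4 * real b ^ 2 * real s ^ 2) \<le> \<bar>x - of_int r / of_nat s\<bar>"
    if ai: "a \<in> A" "i \<in> G a" and x: "x \<in> {f (a, i)..f (a, i) + \<delta> / b}"
      and s: "1 \<le> 2 * b * L * real s ^ 2" "2 * b * (\<delta> / b) * real s ^ 2 < 1" for a i x s and r :: int
  proof (cases "2 * b * \<delta> * real s ^ 2 < 1")
    case True
    have "x \<in> {a..a + \<delta>}" using off[OF ai(2)] x by (auto simp: f_def)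
    then show ?thesis using A(5) ai True s by blast
  next
    case False
    have "x \<in> {a + real i * (\<delta> / b)..a + (real i + 1) * (\<delta> / b)}"
      using x by (simp add: f_def algebra_simps add_divide_distrib)
    moreover have "2 * \<delta> * real s ^ 2 < 1" using s(2) b by simp
    ultimately show ?thesis using G(3)[OF ai(2)] False by (meson not_less)
  qed
  show ?case unfolding l'
  proof (intro exI[of _ "f ` Sigma A G"] conjI card sub ballI impI allI)
    show "finite (f ` Sigma A G)" using A(1) finG by auto
  next
    fix u v assume "u \<in> f ` Sigma A G" "v \<in> f ` Sigma A G" "u \<noteq> v"
    then show "\<delta> / b \<le> \<bar>u - v\<bar>" using sep by auto
  next
    fix u x and r :: int and s :: nat
    assume "u \<in> f ` Sigma A G" "x \<in> {u..u + \<delta> / b}" "1 \<le> 2 * b * L * real s ^ 2"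
      "2 * b * (\<delta> / b) * real s ^ 2 < 1"
    then show "1 / (4 * real b ^ 2 * real s ^ 2) \<le> \<bar>x - of_int r / of_nat s\<bar>"
      using apart by blast
  qed
qed

text \<open>
  Dirichlet's theorem at \<open>m\<close> with bound \<open>N\<close>. The two separation hypotheses force the denominator
  found to be comparable to \<open>N\<close>, since a small denominator would approximate \<open>m\<close> too well.
\<close>

lemma fraction_near_midpoint:
  fixes L \<delta> \<kappa> m :: real and b N :: nat
  assumes "0 < \<delta>" and b: "4 \<le> b" and "0 < \<kappa>" "1 < \<kappa> * N"
    and N: "256 * real b ^ 2 \<le> real N ^ 2 * \<delta>" "real N ^ 2 * \<delta> \<le> 1024 * real b ^ 2"
    and far: "\<And>(r::int) s::nat. 1 \<le> s \<Longrightarrow> 2 * b * L * real s ^ 2 < 1 \<Longrightarrow> \<kappa> \<le> \<bar>m - of_int r / of_nat s\<bar>"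
    and apart: "\<And>(r::int) s::nat. 1 \<le> 2 * b * L * real s ^ 2 \<Longrightarrow> 2 * b * \<delta> * real s ^ 2 < 1 \<Longrightarrow>
      1 / (4 * real b ^ 2 * real s ^ 2) \<le> \<bar>m - of_int r / of_nat s\<bar>"
  obtains r :: int and s :: nat where "coprime r (int s)" "1 \<le> s" "s \<le> N" "real N \<le> 64 * real b ^ 2 * s"
    "\<bar>m - of_int r / of_nat s\<bar> \<le> \<delta> / 4"
proof -
  have N0: "0 < N" using assms(4) by (cases N) auto
  obtain h k where hk: "coprime h k" "0 < k" "k \<le> int N" "\<bar>of_int k * m - of_int h\<bar> < 1 / N"
    using Dirichlet_approx_coprime[OF N0] by blast
  define s where "s = nat k"
  have k: "k = int s" and s: "1 \<le> s" using hk by (auto simp: s_def)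
  have near: "\<bar>m - of_int h / of_nat s\<bar> < 1 / (real s * real N)"
  proof -
    have "\<bar>m - of_int h / of_nat s\<bar> = \<bar>of_int k * m - of_int h\<bar> / real s"
    proof -
      have "m - of_int h / of_nat s = (of_int k * m - of_int h) / real s"
        using s by (simp add: k field_simps)
      then show ?thesis by (simp add: abs_divide)
    qed
    also have "\<dots> < 1 / N / real s" using hk(4) s by (intro divide_strict_right_mono) auto
    finally show ?thesis by (simp add: mult.commute)
  qed
  have large: "1 \<le> 2 * b * L * real s ^ 2"
  proof (rule ccontr)
    assume "\<not> ?thesis"
    then have "\<kappa> \<le> \<bar>m - of_int h / of_nat s\<bar>" using far s by simp
    also have "\<dots> < 1 / (real s * real N)" by (rule near)
    also have "\<dots> \<le> 1 / real N" using s N0 by (simp add: field_simps)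
    finally show False using assms(4) N0 by (simp add: field_simps)
  qed
  have sN: "real N \<le> 64 * real b ^ 2 * s"
  proof (cases "2 * b * \<delta> * real s ^ 2 < 1")
    case True
    then have "1 / (4 * real b ^ 2 * real s ^ 2) < 1 / (real s * real N)"
      using apart[OF large] near by (meson le_less_trans)
    then have "real s * real N < real s * (4 * real b ^ 2 * real s)"
      using s N0 b by (simp add: field_simps power2_eq_square)
    then have "real N < 4 * real b ^ 2 * real s" using s by simp
    also have "\<dots> \<le> 64 * real b ^ 2 * s" by (intro mult_right_mono) auto
    finally show ?thesis by simp
  next
    case False
    have "real N ^ 2 * 1 \<le> real N ^ 2 * (2 * b * \<delta> * real s ^ 2)"
      using False by (intro mult_left_mono) auto
    also have "real N ^ 2 * (2 * b * \<delta> * real s ^ 2) = (real N ^ 2 * \<delta>) * (2 * b * real s ^ 2)" by (simp add: algebra_simps)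
    also have "\<dots> \<le> (1024 * real b ^ 2) * (2 * b * real s ^ 2)" using N by (intro mult_right_mono) auto
    also have "\<dots> = 2048 * (real b ^ 3 * real s ^ 2)" by (simp add: power2_eq_square power3_eq_cube)
    also have "\<dots> \<le> 4096 * (real b ^ 4 * real s ^ 2)"
      using b by (intro mult_mono power_increasing mult_right_mono) auto
    also have "\<dots> = (64 * real b ^ 2 * s) ^ 2" by (simp add: power_mult_distrib flip: power_mult)
    finally have "real N ^ 2 \<le> (64 * real b ^ 2 * s) ^ 2" by simp
    then show ?thesis by (rule power2_le_imp_le) simp
  qed
  have "\<bar>m - of_int h / of_nat s\<bar> \<le> \<delta> / 4"
  proof -
    have "\<bar>m - of_int h / of_nat s\<bar> \<le> 1 / (real s * real N)" using near by simp
    also have "\<dots> \<le> 64 * real b ^ 2 / real N ^ 2" using sN s N0 by (simp add: field_simps power2_eq_square)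
    also have "\<dots> \<le> \<delta> / 4" using N(1) N0 by (simp add: field_simps)
    finally show ?thesis .
  qed
  then show ?thesis using that[of h s] hk s sN k by auto
qed

text \<open>
  The candidates for one coordinate of the next level. The hypothesis \<open>far\<close> handles the denominators
  that are too small to be seen at the scale of the initial interval.
\<close>

lemma separated_fractions:
  fixes x0 L \<kappa> \<delta> :: real and b N j :: nat
  assumes L: "0 < L" and b: "4 \<le> b" and "0 < \<kappa>" "1 < \<kappa> * N" and \<delta>: "\<delta> = L / b ^ j"
    and N: "256 * real b ^ 2 \<le> real N ^ 2 * \<delta>" "real N ^ 2 * \<delta> \<le> 1024 * real b ^ 2"
    and far: "\<And>x (r::int) s::nat. x \<in> {x0..x0 + L} \<Longrightarrow> 1 \<le> s \<Longrightarrow> 2 * b * L * real s ^ 2 < 1 \<Longrightarrow>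
      \<kappa> \<le> \<bar>x - of_int r / of_nat s\<bar>"
  obtains P :: "(int \<times> nat) set" where "finite P" "(b - 3) ^ j \<le> card P"
    "\<And>r s. (r, s) \<in> P \<Longrightarrow> coprime r (int s) \<and> 1 \<le> s \<and> s \<le> N \<and> real N \<le> 64 * real b ^ 2 * s
       \<and> of_int r / of_nat s \<in> {x0 + \<delta> / 4..x0 + L - \<delta> / 4}"
    "\<And>r s x r' s'. (r, s) \<in> P \<Longrightarrow> \<bar>x - of_int r / of_nat s\<bar> \<le> \<delta> / 4 \<Longrightarrow>
       1 \<le> 2 * b * L * real s' ^ 2 \<Longrightarrow> 2 * b * \<delta> * real s' ^ 2 < 1 \<Longrightarrow>
       1 / (4 * real b ^ 2 * real s' ^ 2) \<le> \<bar>x - of_int r' / of_nat s'\<bar>"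
    "\<And>r s r' s'. (r, s) \<in> P \<Longrightarrow> (r', s') \<in> P \<Longrightarrow> (r, s) \<noteq> (r', s') \<Longrightarrow>
       \<delta> / 2 \<le> \<bar>of_int r / of_nat s - of_int r' / of_nat s'\<bar>"
proof -
  have l: "0 < \<delta>" using L b by (simp add: \<delta>)
  have lL: "\<delta> \<le> L"
  proof -
    have "L / real b ^ j \<le> L / 1" using L b by (intro divide_left_mono) auto
    then show ?thesis by (simp add: \<delta>)
  qed
  from badly_approximable_tree[OF L b, of j x0]
  obtain A where A: "finite A" "(b - 3) ^ j \<le> card A"
    "A \<subseteq> {x0..x0 + L - \<delta>}" "\<And>a a'. a \<in> A \<Longrightarrow> a' \<in> A \<Longrightarrow> a \<noteq> a' \<Longrightarrow> \<delta> \<le> \<bar>a - a'\<bar>"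
    "\<And>a x r s. a \<in> A \<Longrightarrow> x \<in> {a..a + \<delta>} \<Longrightarrow> 1 \<le> 2 * b * L * real s ^ 2 \<Longrightarrow> 2 * b * \<delta> * real s ^ 2 < 1 \<Longrightarrow>
      1 / (4 * real b ^ 2 * real s ^ 2) \<le> \<bar>x - of_int r / of_nat s\<bar>"
    unfolding \<delta>[symmetric] by blast
  have "\<exists>f. coprime (fst f) (int (snd f)) \<and> 1 \<le> snd f \<and> snd f \<le> N \<and> real N \<le> 64 * real b ^ 2 * snd f
      \<and> \<bar>(a + \<delta> / 2) - of_int (fst f) / of_nat (snd f)\<bar> \<le> \<delta> / 4" if a: "a \<in> A" for a
  proof -
    have m: "a + \<delta> / 2 \<in> {x0..x0 + L}" "a + \<delta> / 2 \<in> {a..a + \<delta>}" using a A(3) l by auto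
    show ?thesis
      by (rule fraction_near_midpoint[OF l b assms(3,4) N far[OF m(1)] A(5)[OF a m(2)]])
         (auto intro: exI[of _ "(_, _)"])
  qed
  then obtain f where f: "\<And>a. a \<in> A \<Longrightarrow> coprime (fst (f a)) (int (snd (f a))) \<and> 1 \<le> snd (f a) \<and> snd (f a) \<le> N
      \<and> real N \<le> 64 * real b ^ 2 * snd (f a)"
    "\<And>a. a \<in> A \<Longrightarrow> \<bar>(a + \<delta> / 2) - of_int (fst (f a)) / of_nat (snd (f a))\<bar> \<le> \<delta> / 4" by metis
  have sep: "\<delta> / 2 \<le> \<bar>of_int (fst (f a)) / of_nat (snd (f a)) - of_int (fst (f a')) / of_nat (snd (f a'))\<bar>"
    if "a \<in> A" "a' \<in> A" "a \<noteq> a'" for a a'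
    using f(2)[OF that(1)] f(2)[OF that(2)] A(4)[OF that] by linarith
  have inj: "inj_on f A"
    using sep l by (intro inj_onI) fastforce
  show ?thesis
  proof (rule that[of "f ` A"])
    show "finite (f ` A)" using A by simp
    show "(b - 3) ^ j \<le> card (f ` A)" using A inj by (simp add: card_image)
  next
    fix r s assume "(r, s) \<in> f ` A"
    then obtain a where a: "a \<in> A" "r = fst (f a)" "s = snd (f a)" by (metis fst_conv snd_conv imageE)
    then show "coprime r (int s) \<and> 1 \<le> s \<and> s \<le> N \<and> real N \<le> 64 * real b ^ 2 * s
       \<and> of_int r / of_nat s \<in> {x0 + \<delta> / 4..x0 + L - \<delta> / 4}"
    proof -
      have "a \<in> {x0..x0 + L - \<delta>}" using a A(3) by blast
      then have "of_int r / of_nat s \<in> {x0 + \<delta> / 4..x0 + L - \<delta> / 4}"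
        using f(2)[OF a(1)] unfolding a atLeastAtMost_iff by linarith
      then show ?thesis using f(1)[OF a(1)] a by simp
    qed
  next
    fix r s x s' and r' :: int assume "(r, s) \<in> f ` A" and x: "\<bar>x - of_int r / of_nat s\<bar> \<le> \<delta> / 4"
      and s': "1 \<le> 2 * b * L * real s' ^ 2" "2 * b * \<delta> * real s' ^ 2 < 1"
    then obtain a where a: "a \<in> A" "r = fst (f a)" "s = snd (f a)" by (metis fst_conv snd_conv imageE)
    have "x \<in> {a..a + \<delta>}" using f(2)[OF a(1)] x unfolding a atLeastAtMost_iff by linarith
    then show "1 / (4 * real b ^ 2 * real s' ^ 2) \<le> \<bar>x - of_int r' / of_nat s'\<bar>"
      using A(5) a(1) s' by blast
  next
    fix r s r' s' assume "(r, s) \<in> f ` A" "(r', s') \<in> f ` A" "(r, s) \<noteq> (r', s')"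
    then obtain a a' where "a \<in> A" "a' \<in> A" "(r, s) = f a" "(r', s') = f a'" by blast
    then show "\<delta> / 2 \<le> \<bar>of_int r / of_nat s - of_int r' / of_nat s'\<bar>"
      using sep[of a a'] \<open>(r, s) \<noteq> (r', s')\<close> by (metis fst_conv snd_conv)
  qed
qed

section \<open>Boxes around rational points and their counting\<close>

lemma integers_near_subset:
  "{z::int. \<bar>of_int z - y\<bar> \<le> w} = {\<lceil>y - w\<rceil>..\<lfloor>y + w\<rfloor>}" for y w :: real
  by (auto simp: le_floor_iff ceiling_le_iff abs_le_iff)

lemma card_integers_near:
  fixes y w :: real
  shows "2 * w - 1 \<le> real (card {z::int. \<bar>of_int z - y\<bar> \<le> w})"
    and "0 \<le> w \<Longrightarrow> real (card {z::int. \<bar>of_int z - y\<bar> \<le> w}) \<le> 2 * w + 1"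
    and "finite {z::int. \<bar>of_int z - y\<bar> \<le> w}"
proof -
  have c: "card {z::int. \<bar>of_int z - y\<bar> \<le> w} = nat (\<lfloor>y + w\<rfloor> + 1 - \<lceil>y - w\<rceil>)"
    unfolding integers_near_subset by simp
  show "2 * w - 1 \<le> real (card {z::int. \<bar>of_int z - y\<bar> \<le> w})" unfolding c by linarith
  show "0 \<le> w \<Longrightarrow> real (card {z::int. \<bar>of_int z - y\<bar> \<le> w}) \<le> 2 * w + 1" unfolding c by linarith
  show "finite {z::int. \<bar>of_int z - y\<bar> \<le> w}" unfolding integers_near_subset by simp
qed

text \<open>
  Cells of length \<open>g\<close> contain at most one point each.
\<close>

lemma card_separated_le:
  fixes f :: "'a \<Rightarrow> real" and y w g :: real
  assumes "0 < g" "\<And>u. u \<in> P \<Longrightarrow> \<bar>f u - y\<bar> \<le> w"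
    "\<And>u v. u \<in> P \<Longrightarrow> v \<in> P \<Longrightarrow> u \<noteq> v \<Longrightarrow> g \<le> \<bar>f u - f v\<bar>" "0 \<le> w"
  shows "real (card P) \<le> 2 * w / g + 1"
proof -
  define h where "h = (\<lambda>u. \<lfloor>(f u - y + w) / g\<rfloor>)"
  have "inj_on h P"
  proof (rule inj_onI, rule ccontr)
    fix u v assume uv: "u \<in> P" "v \<in> P" "h u = h v" "u \<noteq> v"
    have "\<bar>(f u - y + w) / g - (f v - y + w) / g\<bar> < 1"
      using uv(3) unfolding h_def by linarith
    moreover have "(f u - y + w) / g - (f v - y + w) / g = (f u - f v) / g"
      by (simp flip: diff_divide_distrib)
    ultimately have "\<bar>f u - f v\<bar> < g" using assms(1) by (simp add: abs_divide)
    then show False using assms(3)[OF uv(1,2,4)] by simp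
  qed
  moreover have "h ` P \<subseteq> {0..\<lfloor>2 * w / g\<rfloor>}"
  proof
    fix z assume "z \<in> h ` P"
    then obtain u where u: "u \<in> P" "z = h u" by auto
    have "0 \<le> f u - y + w" "f u - y + w \<le> 2 * w" using assms(2)[OF u(1)] by linarith+
    then show "z \<in> {0..\<lfloor>2 * w / g\<rfloor>}"
      using assms(1) by (auto simp: u h_def intro!: floor_mono divide_right_mono)
  qed
  ultimately have "card P \<le> card {0..\<lfloor>2 * w / g\<rfloor>}" by (intro card_inj_on_le) auto
  then have "real (card P) \<le> real (nat (\<lfloor>2 * w / g\<rfloor> + 1))" by simp
  also have "\<dots> \<le> 2 * w / g + 1"
    using assms(1,4) by simp
  finally show ?thesis .
qed

lemma min_1_power_le_powr:
  fixes X t :: real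
  assumes "0 < t" "t \<le> real m" "0 < X"
  shows "min 1 (X ^ m) \<le> X powr t"
proof (cases "X \<le> 1")
  case True
  have "X ^ m = X powr real m" using assms(3) by (simp add: powr_realpow)
  also have "\<dots> \<le> X powr t" using True assms by (intro powr_mono') auto
  finally show ?thesis by simp
next
  case False
  then have "1 \<le> X powr t" using assms(1) by (intro ge_one_powr_ge_zero) auto
  then show ?thesis by simp
qed

text \<open>
  The coordinate that carries exactness is \<open>i0\<close>. Each step of the subdivision is into \<open>b\<close> parts, of
  which \<open>b - 3\<close>, or \<open>b powr \<theta>\<close>, are kept; \<open>mu\<close> is an exponent slightly above the order of
  \<open>1 / \<psi>\<close>; from \<open>s0\<close> on, \<open>\<psi>\<close> has its asymptotic behaviour; and \<open>t\<close> is the exponent for which the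
  Hausdorff measure is shown to be positive. The inequality \<open>exponent\<close> says that a node has more
  children than \<open>\<psi> powr - t\<close> at the scale of the children.
\<close>

locale exact_tree =
  fixes \<psi> :: "nat \<Rightarrow> real" and i0 :: "'n::finite" and b s0 :: nat and t mu \<theta> :: real
  assumes \<psi>_range: "\<And>q. 1 \<le> q \<Longrightarrow> \<psi> q \<in> {0<..1}"
    and \<psi>_anti: "\<And>q q'. 1 \<le> q \<Longrightarrow> q \<le> q' \<Longrightarrow> \<psi> q' \<le> \<psi> q"
    and \<psi>_lim: "(\<lambda>q. (real q)\<^sup>2 * \<psi> q) \<longlonglongrightarrow> 0"
    and b: "4 \<le> b" and \<theta>: "0 < \<theta>" "real b powr \<theta> = real (b - 3)"
    and s0: "2 \<le> s0" "\<And>q. s0 \<le> q \<Longrightarrow> 128 * real b ^ 2 * (real q ^ 2 * \<psi> q) \<le> 1"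
      "\<And>q. s0 \<le> q \<Longrightarrow> real q powr - mu \<le> \<psi> q"
    and t: "0 < t" "t \<le> real (CARD('n) - 1)" and mu: "2 \<le> mu"
    and exponent: "t * mu < 2 * \<theta> + real (CARD('n) - 1)" and dim: "3 \<le> CARD('n)"
begin

definition \<eta> :: "nat \<Rightarrow> real" where "\<eta> k = 1 / (real k + 2)"

text \<open>
  A node \<open>(k, q, p)\<close> is a rational point \<open>p/q\<close> chosen at level \<open>k\<close>. The bound on \<open>q\<^sup>2 \<psi> q\<close> makes
  \<open>q\<close> large in terms of \<open>\<eta> k\<close>, so that the thin shell about \<open>p/q\<close> is still long in comparison with
  \<open>1 / S\<^sup>2\<close>, where \<open>S\<close> is the first denominator of another fraction that can be near the shell.
\<close>

definition nodes :: "(nat \<times> nat \<times> (int ^ 'n)) set" where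
  "nodes = {(k, q, p). s0 \<le> q \<and> coprime (p $ i0) (int q) \<and> real q ^ 2 * \<psi> q \<le> real b * \<eta> k / 4}"

text \<open>
  The shell is an interval on the right of \<open>p/q\<close>, at a distance just below \<open>\<psi> q\<close>.
\<close>

definition shell_start :: "nat \<Rightarrow> nat \<Rightarrow> int ^ 'n \<Rightarrow> real" where
  "shell_start k q p = of_int (p $ i0) / of_nat q + (1 - \<eta> k) * \<psi> q"

definition shell_length :: "nat \<Rightarrow> nat \<Rightarrow> real" where
  "shell_length k q = \<eta> k * \<psi> q / 2"

fun node_box :: "nat \<times> nat \<times> (int ^ 'n) \<Rightarrow> (real ^ 'n) set" where
  "node_box (k, q, p) = cbox
    (\<chi> i. if i = i0 then shell_start k q p else of_int (p $ i) / of_nat q - \<psi> q / 2)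
    (\<chi> i. if i = i0 then shell_start k q p + shell_length k q else of_int (p $ i) / of_nat q + \<psi> q / 2)"

fun node_size :: "nat \<times> nat \<times> (int ^ 'n) \<Rightarrow> real" where
  "node_size (k, q, p) = \<psi> q"

lemma mem_node_box:
  "\<alpha> \<in> node_box (k, q, p) \<longleftrightarrow> \<alpha> $ i0 \<in> {shell_start k q p..shell_start k q p + shell_length k q} \<and>
    (\<forall>i. i \<noteq> i0 \<longrightarrow> \<bar>\<alpha> $ i - of_int (p $ i) / of_nat q\<bar> \<le> \<psi> q / 2)"
proof -
  have "\<bar>x - y\<bar> \<le> \<psi> q / 2 \<longleftrightarrow> y - \<psi> q / 2 \<le> x \<and> x \<le> y + \<psi> q / 2" for x y by linarith
  then show ?thesis by (auto simp: mem_box_cart)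
qed

declare node_box.simps [simp del]

lemma \<eta>_bounds: "0 < \<eta> k" "\<eta> k \<le> 1/2"
  by (auto simp: \<eta>_def field_simps)

lemma node_props:
  assumes "(k, q, p) \<in> nodes"
  shows "2 \<le> q" "s0 \<le> q" "0 < \<psi> q" "\<psi> q \<le> 1" "coprime (p $ i0) (int q)"
    "real q ^ 2 * \<psi> q \<le> real b * \<eta> k / 4" "0 < shell_length k q" "shell_length k q \<le> 1"
proof -
  show *: "2 \<le> q" "s0 \<le> q" "0 < \<psi> q" "\<psi> q \<le> 1" "coprime (p $ i0) (int q)"
    "real q ^ 2 * \<psi> q \<le> real b * \<eta> k / 4"
    using assms s0(1) \<psi>_range[of q] by (auto simp: nodes_def)
  show "0 < shell_length k q" using \<eta>_bounds[of k] * by (simp add: shell_length_def)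
  have "\<eta> k * \<psi> q \<le> 1 * 1" using \<eta>_bounds[of k] * by (intro mult_mono) auto
  then show "shell_length k q \<le> 1" by (simp add: shell_length_def)
qed

lemma shell_offset:
  assumes "(k, q, p) \<in> nodes" "x \<in> {shell_start k q p..shell_start k q p + shell_length k q}"
  shows "(1 - \<eta> k) * \<psi> q \<le> x - of_int (p $ i0) / of_nat q" "x - of_int (p $ i0) / of_nat q \<le> (1 - \<eta> k / 2) * \<psi> q"
    "\<bar>x - of_int (p $ i0) / of_nat q\<bar> < \<psi> q"
proof -
  show 1: "(1 - \<eta> k) * \<psi> q \<le> x - of_int (p $ i0) / of_nat q" "x - of_int (p $ i0) / of_nat q \<le> (1 - \<eta> k / 2) * \<psi> q"
    using assms(2) by (auto simp: shell_start_def shell_length_def algebra_simps)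
  have "0 \<le> (1 - \<eta> k) * \<psi> q" using \<eta>_bounds[of k] node_props(3)[OF assms(1)] by simp
  moreover have "(1 - \<eta> k / 2) * \<psi> q < 1 * \<psi> q"
    using \<eta>_bounds[of k] node_props(3)[OF assms(1)] by (intro mult_strict_right_mono) auto
  ultimately show "\<bar>x - of_int (p $ i0) / of_nat q\<bar> < \<psi> q" using 1 by linarith
qed

text \<open>
  A fraction equal to \<open>p/q\<close> is at the distance prescribed by the shell. A different one is at least
  \<open>1 / (s' q)\<close> away from \<open>p/q\<close>, and for the given range of \<open>s'\<close> this is at least \<open>2 \<psi> q\<close>.
\<close>

lemma shell_avoids_small_denominators:
  fixes r' :: int
  assumes v: "(k, q, p) \<in> nodes" and x: "x \<in> {shell_start k q p..shell_start k q p + shell_length k q}"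
    and s': "1 \<le> s'" "2 * b * shell_length k q * real s' ^ 2 < 1"
  shows "(1 - \<eta> k) * \<psi> q \<le> \<bar>x - of_int r' / of_nat s'\<bar>"
proof (cases "of_int r' / of_nat s' = (of_int (p $ i0) / of_nat q :: real)")
  case True
  then show ?thesis using shell_offset(1)[OF v x] by linarith
next
  case False
  note v' = node_props[OF v]
  have "(2 * \<psi> q * real s' * real q) ^ 2 = 4 * \<psi> q * (real q ^ 2 * \<psi> q) * real s' ^ 2"
    by (simp add: power2_eq_square)
  also have "\<dots> \<le> 4 * \<psi> q * (real b * \<eta> k / 4) * real s' ^ 2"
    using v' by (intro mult_right_mono mult_left_mono) auto
  also have "\<dots> = 2 * b * shell_length k q * real s' ^ 2" by (simp add: shell_length_def)
  also have "\<dots> \<le> 1 ^ 2" using s' by simp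
  finally have "2 * \<psi> q * real s' * real q \<le> 1" by (rule power2_le_imp_le) simp
  then have "2 * \<psi> q \<le> 1 / (real s' * real q)" using s' v'(1) by (simp add: field_simps)
  also have "\<dots> \<le> \<bar>of_int r' / of_nat s' - of_int (p $ i0) / of_nat q\<bar>"
    using fraction_gap[OF _ _ False] s' v'(1) by simp
  finally have "\<psi> q \<le> \<bar>x - of_int r' / of_nat s'\<bar>" using shell_offset(3)[OF v x] by linarith
  moreover have "(1 - \<eta> k) * \<psi> q \<le> 1 * \<psi> q" using \<eta>_bounds[of k] v' by (intro mult_right_mono) auto
  ultimately show ?thesis by linarith
qed

text \<open>
  A node has at least \<open>scale_const k q * \<delta> powr - growth\<close> children when coordinate \<open>i0\<close> has been
  subdivided down to length \<open>\<delta>\<close>: the choices in that coordinate contribute \<open>\<theta>\<close>, and the others, with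
  denominators of order \<open>\<delta> powr (-1/2)\<close>, contribute one half each.
\<close>

definition growth :: real where "growth = \<theta> + real (CARD('n) - 1) / 2"

definition scale_const :: "nat \<Rightarrow> nat \<Rightarrow> real" where
  "scale_const k q = shell_length k q powr \<theta> * (\<psi> q / (16 * b)) ^ (CARD('n) - 1)"

lemma growth_gt: "max t 1 < growth"
proof -
  have "t * 2 \<le> t * mu" using t mu by (intro mult_left_mono) auto
  then have "t < growth" using exponent unfolding growth_def by linarith
  moreover have "1 < growth"
  proof -
    have "real 2 \<le> real (CARD('n) - 1)" unfolding of_nat_le_iff using dim by simp
    then show ?thesis using \<theta>(1) unfolding growth_def by linarith
  qed
  ultimately show ?thesis by simp
qed

text \<open>
  All requirements on the next scale hold once \<open>\<delta>\<close> is small in terms of the node: every constant that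
  depends on the node is beaten by a power of \<open>\<delta>\<close>. The bound \<open>N\<close> for the denominators is of order
  \<open>\<delta> powr (-1/2)\<close>.
\<close>

lemma choose_scale:
  fixes T :: nat and \<kappa> :: real
  assumes v: "(k, q, p) \<in> nodes" and \<kappa>: "0 < \<kappa>"
  obtains j N :: nat and \<delta> :: real where "\<delta> = shell_length k q / b ^ j" "0 < \<delta>" "1 < \<kappa> * N"
    "64 * real b ^ 2 * real T \<le> N" "real N * \<delta> \<le> 2"
    "256 * real b ^ 2 \<le> real N ^ 2 * \<delta>" "real N ^ 2 * \<delta> \<le> 1024 * real b ^ 2"
    "16 * b * \<delta> powr (-1/2) \<le> N" "N \<le> 32 * b * \<delta> powr (-1/2)"
    "10 * 4 ^ (CARD('n) - 1) * 4 powr (max t 1 - 1) * \<delta> powr (growth - max t 1) \<le> scale_const k q"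
    "1 \<le> scale_const k q * \<delta> powr - growth * ((32 * b) powr - mu * \<delta> powr (mu / 2)) powr t"
proof -
  note v' = node_props[OF v]
  define L where "L = shell_length k q"
  define K where "K = scale_const k q"
  have L: "0 < L" "L \<le> 1" using v' by (auto simp: L_def)
  have K: "0 < K" using v' b L unfolding K_def scale_const_def L_def by (intro mult_pos_pos zero_less_power) auto
  have b0: "0 < real b" using b by simp
  \<comment> \<open>The scale must make \<open>N\<close> at least \<open>X\<close>; the exponents \<open>e1\<close> and \<open>e2\<close> are the margins in the last two conclusions.\<close>
  define X where "X = max (2 / \<kappa>) (64 * real b ^ 2 * real T)"
  define e1 where "e1 = growth - max t 1"
  have e1: "0 < e1" using growth_gt by (simp add: e1_def)
  define e2 where "e2 = growth - t * mu / 2"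
  have e2: "0 < e2" using exponent unfolding e2_def growth_def by linarith
  define c1 where "c1 = 10 * 4 ^ (CARD('n) - 1) * 4 powr (max t 1 - 1)"
  have ev: "\<forall>\<^sub>F \<delta> in at_right 0. \<delta> > 0 \<and> \<delta> < 1 \<and> X \<le> 16 * b * \<delta> powr (-1/2) \<and> 32 * b * \<delta> powr (1/2) \<le> 2 \<and>
      c1 * \<delta> powr e1 \<le> K \<and> 1 \<le> K * (32 * b) powr (- mu * t) * \<delta> powr - e2"
  proof (intro eventually_conj)
    show "\<forall>\<^sub>F \<delta> in at_right 0. (\<delta>::real) > 0" by (rule eventually_at_right_less)
    show "\<forall>\<^sub>F \<delta> in at_right 0. (\<delta>::real) < 1" by (rule eventually_at_right_real[of 0 1, THEN eventually_mono]) auto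
    have "filterlim (\<lambda>\<delta>. 16 * real b * \<delta> powr (-1/2)) at_top (at_right 0)" using b0 by real_asymp
    then show "\<forall>\<^sub>F \<delta> in at_right 0. X \<le> 16 * b * \<delta> powr (-1/2)" by (simp add: filterlim_at_top)
    have "((\<lambda>\<delta>. 32 * real b * \<delta> powr (1/2)) \<longlongrightarrow> 0) (at_right 0)" using b0 by real_asymp
    from order_tendstoD(2)[OF this, of 2]
    show "\<forall>\<^sub>F \<delta> in at_right 0. 32 * b * \<delta> powr (1/2) \<le> 2" by (auto elim: eventually_mono)
    have "((\<lambda>\<delta>. c1 * \<delta> powr e1) \<longlongrightarrow> 0) (at_right 0)" using e1 by real_asymp
    from order_tendstoD(2)[OF this K]
    show "\<forall>\<^sub>F \<delta> in at_right 0. c1 * \<delta> powr e1 \<le> K" by (auto elim: eventually_mono)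
    have c: "0 < K * (32 * b) powr (- mu * t)" using K b0 by simp
    have "filterlim (\<lambda>\<delta>. K * (32 * b) powr (- mu * t) * \<delta> powr - e2) at_top (at_right 0)"
      using e2 c by real_asymp
    then show "\<forall>\<^sub>F \<delta> in at_right 0. 1 \<le> K * (32 * b) powr (- mu * t) * \<delta> powr - e2"
      by (simp add: filterlim_at_top)
  qed
  have "filterlim (\<lambda>j. L / real b ^ j) (at_right 0) sequentially"
  proof -
    have "1 < real b" using b by simp
    then show ?thesis using L by real_asymp
  qed
  from eventually_happens'[OF _ eventually_compose_filterlim[OF ev this]]
  obtain j where j: "L / real b ^ j > 0" "L / real b ^ j < 1" "X \<le> 16 * b * (L / real b ^ j) powr (-1/2)"
      "32 * b * (L / real b ^ j) powr (1/2) \<le> 2"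
      "c1 * (L / real b ^ j) powr e1 \<le> K" "1 \<le> K * (32 * b) powr (- mu * t) * (L / real b ^ j) powr - e2" by auto
  define \<delta> where "\<delta> = L / real b ^ j"
  note j = j[folded \<delta>_def]
  define y where "y = \<delta> powr (-1/2)"
  have y: "1 \<le> y" "y * y * \<delta> = 1" "y * \<delta> = \<delta> powr (1/2)"
  proof -
    have "\<delta> powr 0 \<le> y" unfolding y_def using j by (intro powr_mono') auto
    then show "1 \<le> y" using j by simp
    have "\<delta> powr 1 = \<delta>" using j(1) by simp
    moreover have "y * y * \<delta> powr 1 = \<delta> powr (-1/2 + -1/2 + 1)" "y * \<delta> powr 1 = \<delta> powr (-1/2 + 1)"
      unfolding y_def powr_add by (rule refl)+
    ultimately show "y * y * \<delta> = 1" "y * \<delta> = \<delta> powr (1/2)" using j(1) by simp_all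
  qed
  define N where "N = nat \<lceil>16 * b * y\<rceil>"
  have N1: "16 * b * y \<le> N" unfolding N_def by linarith
  have N2: "N \<le> 32 * b * y"
  proof -
    have p: "0 \<le> 16 * b * y" using y by simp
    have "1 * 1 \<le> b * y" using y b by (intro mult_mono) auto
    then show ?thesis using p unfolding N_def by linarith
  qed
  have X: "X \<le> N" using j(3) N1 by (simp add: y_def)
  show ?thesis
  proof (rule that[of \<delta> j N])
    show "\<delta> = shell_length k q / real (b ^ j)" by (simp add: \<delta>_def L_def)
    show "0 < \<delta>" by (rule j)
    show "1 < \<kappa> * N"
    proof -
      have "2 / \<kappa> \<le> N" using X by (simp add: X_def)
      then show ?thesis using \<kappa> by (simp add: field_simps)
    qed
    show "64 * real b ^ 2 * real T \<le> N" using X by (simp add: X_def)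
    show "real N * \<delta> \<le> 2"
    proof -
      have "real N * \<delta> \<le> 32 * b * y * \<delta>" using N2 j by (intro mult_right_mono) auto
      also have "\<dots> = 32 * b * \<delta> powr (1/2)" using y(3) by simp
      finally show ?thesis using j(4) by linarith
    qed
    show "256 * real b ^ 2 \<le> real N ^ 2 * \<delta>"
    proof -
      have "256 * real b ^ 2 = (16 * b * y) ^ 2 * \<delta>" using y(2) by (simp add: power2_eq_square)
      also have "\<dots> \<le> real N ^ 2 * \<delta>" using N1 y(1) j by (intro mult_right_mono power_mono) auto
      finally show ?thesis .
    qed
    show "real N ^ 2 * \<delta> \<le> 1024 * real b ^ 2"
    proof -
      have "real N ^ 2 * \<delta> \<le> (32 * b * y) ^ 2 * \<delta>" using N2 j by (intro mult_right_mono power_mono) auto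
      also have "\<dots> = 1024 * real b ^ 2" using y(2) by (simp add: power2_eq_square)
      finally show ?thesis .
    qed
    show "16 * b * \<delta> powr (-1/2) \<le> N" "N \<le> 32 * b * \<delta> powr (-1/2)" using N1 N2 by (simp_all add: y_def)
    show "10 * 4 ^ (CARD('n) - 1) * 4 powr (max t 1 - 1) * \<delta> powr (growth - max t 1) \<le> scale_const k q"
      using j(5) by (simp add: c1_def e1_def K_def)
    have eq: "((32 * b) powr - mu * \<delta> powr (mu / 2)) powr t = (32 * b) powr (- mu * t) * \<delta> powr (mu * t / 2)"
      by (simp add: powr_mult powr_powr)
    have eq2: "\<delta> powr - growth * \<delta> powr (mu * t / 2) = \<delta> powr - e2"
      by (simp add: e2_def mult.commute flip: powr_add)
    have "K * \<delta> powr - growth * ((32 * b) powr - mu * \<delta> powr (mu / 2)) powr t =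
        K * (32 * b) powr (- mu * t) * (\<delta> powr - growth * \<delta> powr (mu * t / 2))"
      unfolding eq by (simp only: mult_ac)
    then show "1 \<le> scale_const k q * \<delta> powr - growth * ((32 * b) powr - mu * \<delta> powr (mu / 2)) powr t"
      using j(6) unfolding eq2 K_def by (simp only:)
  qed
qed

lemma denominator_threshold:
  assumes v: "(k, q, p) \<in> nodes"
  obtains T :: nat where "\<And>s. T \<le> s \<Longrightarrow> s0 \<le> s \<and> q < s \<and> real s ^ 2 * \<psi> s \<le> real b * \<eta> (Suc k) / 4 \<and>
     2 * \<psi> s \<le> \<psi> q \<and> 4 \<le> real s * \<psi> q"
proof -
  note v' = node_props[OF v]
  have "\<forall>\<^sub>F s in sequentially. real s ^ 2 * \<psi> s < real b * \<eta> (Suc k) / 4"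
    using \<eta>_bounds[of "Suc k"] b by (intro order_tendstoD(2)[OF \<psi>_lim]) auto
  moreover have "\<forall>\<^sub>F s in sequentially. real s ^ 2 * \<psi> s < \<psi> q / 2"
    using v' by (intro order_tendstoD(2)[OF \<psi>_lim]) auto
  moreover have "\<forall>\<^sub>F s in sequentially. 4 / \<psi> q \<le> real s" by real_asymp
  moreover have "\<forall>\<^sub>F s in sequentially. max s0 (Suc q) \<le> s" by (rule eventually_ge_at_top)
  ultimately have "\<forall>\<^sub>F s in sequentially. s0 \<le> s \<and> q < s \<and> real s ^ 2 * \<psi> s \<le> real b * \<eta> (Suc k) / 4 \<and>
     2 * \<psi> s \<le> \<psi> q \<and> 4 \<le> real s * \<psi> q"
  proof eventually_elim
    case (elim s)
    have s: "1 \<le> s" using elim by simp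
    then have "1 * \<psi> s \<le> real s ^ 2 * \<psi> s" using \<psi>_range[of s] by (intro mult_right_mono one_le_power) auto
    then show ?case using elim v' by (simp add: field_simps)
  qed
  then show ?thesis using that by (auto simp: eventually_sequentially)
qed

text \<open>
  The last clause is the contribution of one step to exactness: the coordinate \<open>i0\<close> stays away from all
  fractions with denominators from \<open>q\<close> up to the next one.
\<close>

definition descends :: "nat \<times> nat \<times> (int ^ 'n) \<Rightarrow> nat \<times> nat \<times> (int ^ 'n) \<Rightarrow> bool" where
  "descends v c \<longleftrightarrow> (case v of (k, q, p) \<Rightarrow> case c of (k', s, p') \<Rightarrow>
     k' = Suc k \<and> q < s \<and> c \<in> nodes \<and> node_box c \<subseteq> node_box v \<and> 2 * \<psi> s \<le> \<psi> q \<and>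
     (\<forall>\<alpha>\<in>node_box c. \<forall>s' (r'::int). q \<le> s' \<longrightarrow> s' < s \<longrightarrow>
        (1 - \<eta> k) * \<psi> s' \<le> \<bar>\<alpha> $ i0 - of_int r' / of_nat s'\<bar>))"


definition numerator_choices :: "nat \<Rightarrow> int ^ 'n \<Rightarrow> int \<times> nat \<Rightarrow> (int ^ 'n) set" where
  "numerator_choices q p = (\<lambda>(r, s). {p'. \<forall>i. p' $ i \<in>
     (if i = i0 then {r} else {z. \<bar>of_int z / of_nat s - of_int (p $ i) / of_nat q\<bar> \<le> \<psi> q / 4})})"

definition child_nodes :: "nat \<times> nat \<times> (int ^ 'n) \<Rightarrow> (int \<times> nat) set \<Rightarrow> (nat \<times> nat \<times> (int ^ 'n)) set" where
  "child_nodes v P = (case v of (k, q, p) \<Rightarrow>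
     (\<lambda>((r, s), p'). (Suc k, s, p')) ` Sigma P (numerator_choices q p))"

lemma mem_child_nodes:
  "(k', s, p') \<in> child_nodes (k, q, p) P \<longleftrightarrow> k' = Suc k \<and> (p' $ i0, s) \<in> P \<and>
     (\<forall>i. i \<noteq> i0 \<longrightarrow> \<bar>of_int (p' $ i) / of_nat s - of_int (p $ i) / of_nat q\<bar> \<le> \<psi> q / 4)"
  (is "?l \<longleftrightarrow> ?r")
proof
  assume ?l
  then obtain r where "k' = Suc k" "(r, s) \<in> P" "p' \<in> numerator_choices q p (r, s)"
    unfolding child_nodes_def by auto
  moreover from this(3) have "p' $ i \<in> (if i = i0 then {r} else
      {z. \<bar>of_int z / of_nat s - of_int (p $ i) / of_nat q\<bar> \<le> \<psi> q / 4})" for i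
    by (simp add: numerator_choices_def)
  ultimately show ?r by (metis (lifting) mem_Collect_eq singletonD)
next
  assume r: ?r
  then have "((p' $ i0, s), p') \<in> Sigma P (numerator_choices q p)"
    by (simp add: numerator_choices_def)
  then show ?l using r unfolding child_nodes_def by (auto intro: image_eqI[rotated])
qed

text \<open>
  Coordinate \<open>i0\<close> is determined by the fraction chosen there and contributes no factor.
\<close>

lemma card_slice:
  fixes S :: "'n \<Rightarrow> 'b set"
  shows "card {x :: 'b ^ 'n. \<forall>i. x $ i \<in> (if i = i0 then {r} else S i)} = (\<Prod>i\<in>UNIV - {i0}. card (S i))"
proof -
  have "card {x :: 'b ^ 'n. \<forall>i. x $ i \<in> (if i = i0 then {r} else S i)} =
      (\<Prod>i\<in>UNIV. card (if i = i0 then {r} else S i))"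
    by (rule card_vec_components)
  also have "\<dots> = card {r} * (\<Prod>i\<in>UNIV - {i0}. card (if i = i0 then {r} else S i))"
    by (subst prod.remove[of UNIV i0]) auto
  also have "(\<Prod>i\<in>UNIV - {i0}. card (if i = i0 then {r} else S i)) = (\<Prod>i\<in>UNIV - {i0}. card (S i))"
    by (rule prod.cong) auto
  finally show ?thesis by simp
qed

lemma fractions_near_eq:
  fixes y w :: real
  assumes "1 \<le> s"
  shows "{z::int. \<bar>of_int z / of_nat s - y\<bar> \<le> w} = {z. \<bar>of_int z - real s * y\<bar> \<le> real s * w}"
proof -
  have "\<bar>of_int z - real s * y\<bar> = real s * \<bar>of_int z / of_nat s - y\<bar>" for z :: int
  proof -
    have "of_int z - real s * y = real s * (of_int z / of_nat s - y)" using assms by (simp add: field_simps)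
    then show ?thesis by (simp add: abs_mult)
  qed
  then show ?thesis using assms by (auto simp: mult_le_cancel_left)
qed

lemma finite_numerator_choices:
  assumes "1 \<le> s"
  shows "finite (numerator_choices q p (r, s))"
  unfolding numerator_choices_def prod.case fractions_near_eq[OF assms]
  by (rule finite_vec_components) (split if_split, intro conjI impI finite.intros card_integers_near(3))

lemma card_numerator_choices_ge:
  assumes "1 \<le> s" "4 \<le> real s * \<psi> q"
  shows "(real s * \<psi> q / 4) ^ (CARD('n) - 1) \<le> real (card (numerator_choices q p (r, s)))"
proof -
  have "(real s * \<psi> q / 4) ^ (CARD('n) - 1) = (\<Prod>i\<in>UNIV - {i0}. real s * \<psi> q / 4)"
    by (simp add: card_Diff_singleton)
  also have "\<dots> \<le> (\<Prod>i\<in>UNIV - {i0}. real (card {z::int. \<bar>of_int z - real s * (of_int (p $ i) / of_nat q)\<bar> \<le> real s * (\<psi> q / 4)}))"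
  proof (rule prod_mono, intro conjI)
    fix i
    show "real s * \<psi> q / 4 \<le> real (card {z::int. \<bar>of_int z - real s * (of_int (p $ i) / of_nat q)\<bar> \<le> real s * (\<psi> q / 4)})"
      using card_integers_near(1)[of "real s * (\<psi> q / 4)" "real s * (of_int (p $ i) / of_nat q)"] assms(2) by simp
    show "0 \<le> real s * \<psi> q / 4" using assms(2) by simp
  qed
  finally show ?thesis
    unfolding numerator_choices_def prod.case card_slice fractions_near_eq[OF assms(1)] by simp
qed

lemma finite_child_nodes:
  assumes "finite P" "\<And>r s. (r, s) \<in> P \<Longrightarrow> 1 \<le> s"
  shows "finite (child_nodes (k, q, p) P)"
  unfolding child_nodes_def prod.case using assms
  by (intro finite_imageI finite_SigmaI) (auto intro: finite_numerator_choices)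

lemma card_child_nodes_ge:
  fixes K :: real
  assumes P: "finite P" and s: "\<And>r s. (r, s) \<in> P \<Longrightarrow> 1 \<le> s \<and> 4 \<le> real s * \<psi> q \<and> K \<le> real s * \<psi> q / 4"
    and K: "0 \<le> K"
  shows "real (card P) * K ^ (CARD('n) - 1) \<le> real (card (child_nodes (k, q, p) P))"
proof -
  have "inj_on (\<lambda>((r, s), p'). (Suc k, s, p')) (Sigma P (numerator_choices q p))"
  proof (rule inj_onI, clarsimp)
    fix r r' s and p' :: "int ^ 'n"
    assume "p' \<in> numerator_choices q p (r, s)" "p' \<in> numerator_choices q p (r', s)"
    then have "p' $ i0 = r" "p' $ i0 = r'" by (auto simp: numerator_choices_def dest: spec[of _ i0])
    then show "r = r'" by simp
  qed
  then have "card (child_nodes (k, q, p) P) = card (Sigma P (numerator_choices q p))"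
    unfolding child_nodes_def prod.case by (rule card_image)
  also have "\<dots> = (\<Sum>u\<in>P. card (numerator_choices q p u))"
    using P s by (intro card_SigmaI) (auto intro: finite_numerator_choices)
  finally have c: "real (card (child_nodes (k, q, p) P)) = (\<Sum>u\<in>P. real (card (numerator_choices q p u)))"
    by simp
  have "real (card P) * K ^ (CARD('n) - 1) = (\<Sum>u\<in>P. K ^ (CARD('n) - 1))" by simp
  also have "\<dots> \<le> (\<Sum>u\<in>P. real (card (numerator_choices q p u)))"
  proof (rule sum_mono)
    fix u assume u: "u \<in> P"
    obtain r s' where rs: "u = (r, s')" by fastforce
    have "K ^ (CARD('n) - 1) \<le> (real s' * \<psi> q / 4) ^ (CARD('n) - 1)"
      using s[of r s'] u K rs by (intro power_mono) auto
    also have "\<dots> \<le> real (card (numerator_choices q p u))"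
      unfolding rs using s[of r s'] u rs by (intro card_numerator_choices_ge) auto
    finally show "K ^ (CARD('n) - 1) \<le> real (card (numerator_choices q p u))" .
  qed
  finally show ?thesis using c by simp
qed

text \<open>
  The upper count needed for the spread of mass: near the point \<open>u\<close>, each coordinate other than \<open>i0\<close>
  has at most \<open>2 N d + 2\<close> numerators over a given denominator.
\<close>

lemma card_nodes_near_point:
  fixes u :: "real ^ 'n" and d :: real and M :: "(nat \<times> nat \<times> (int ^ 'n)) set"
  assumes P: "finite P" and s: "\<And>r s. (r, s) \<in> P \<Longrightarrow> 1 \<le> s \<and> s \<le> N \<and> real s * \<psi> s \<le> 1"
    and d: "0 \<le> d"
    and M: "\<And>k' s p'. (k', s, p') \<in> M \<Longrightarrow> k' = k \<and> (p' $ i0, s) \<in> P \<and>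
      (\<forall>i. i \<noteq> i0 \<longrightarrow> \<bar>of_int (p' $ i) / of_nat s - u $ i\<bar> \<le> d + \<psi> s / 2)"
  shows "real (card M) \<le> real (card P) * (2 * (real N * d) + 2) ^ (CARD('n) - 1)"
proof -
  define T where "T = (\<lambda>(r, s). {p' :: int ^ 'n. \<forall>i. p' $ i \<in>
     (if i = i0 then {r} else {z. \<bar>of_int z / of_nat s - u $ i\<bar> \<le> d + \<psi> s / 2})})"
  have finT: "finite (T (r, s))" if "(r, s) \<in> P" for r s
  proof -
    have s1: "1 \<le> s" using that assms(2) by blast
    show ?thesis unfolding T_def prod.case fractions_near_eq[OF s1]
      by (rule finite_vec_components) (split if_split, intro conjI impI finite.intros card_integers_near(3))
  qed
  have cardT: "real (card (T (r, s))) \<le> (2 * (real N * d) + 2) ^ (CARD('n) - 1)" if rs: "(r, s) \<in> P" for r s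
  proof -
    have s1: "1 \<le> s" "s \<le> N" "real s * \<psi> s \<le> 1" using rs assms(2) by blast+
    have w: "0 \<le> real s * (d + \<psi> s / 2)" using d \<psi>_range[OF s1(1)] by simp
    have "real (card (T (r, s))) = (\<Prod>i\<in>UNIV - {i0}. real (card {z::int. \<bar>of_int z - real s * (u $ i)\<bar> \<le> real s * (d + \<psi> s / 2)}))"
      unfolding T_def prod.case card_slice fractions_near_eq[OF s1(1)] by simp
    also have "\<dots> \<le> (\<Prod>i\<in>UNIV - {i0}. 2 * (real N * d) + 2)"
    proof (rule prod_mono, intro conjI)
      fix i
      have "real (card {z::int. \<bar>of_int z - real s * (u $ i)\<bar> \<le> real s * (d + \<psi> s / 2)}) \<le> 2 * (real s * (d + \<psi> s / 2)) + 1"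
        by (rule card_integers_near(2)[OF w])
      also have "\<dots> = 2 * (real s * d) + real s * \<psi> s + 1" by (simp add: algebra_simps)
      also have "\<dots> \<le> 2 * (real N * d) + 1 + 1" using s1 d by (intro add_mono mult_left_mono mult_right_mono) auto
      finally show "real (card {z::int. \<bar>of_int z - real s * (u $ i)\<bar> \<le> real s * (d + \<psi> s / 2)}) \<le> 2 * (real N * d) + 2"
        by simp
    qed simp
    also have "\<dots> = (2 * (real N * d) + 2) ^ (CARD('n) - 1)" by (simp add: card_Diff_singleton)
    finally show ?thesis .
  qed
  have "M \<subseteq> (\<lambda>((r, s), p'). (k, s, p')) ` Sigma P T"
  proof
    fix c assume c: "c \<in> M"
    obtain k' s p' where ksp: "c = (k', s, p')" by (metis prod_cases3)
    have "((p' $ i0, s), p') \<in> Sigma P T" "k' = k" using M[of k' s p'] c ksp by (auto simp: T_def)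
    then show "c \<in> (\<lambda>((r, s), p'). (k, s, p')) ` Sigma P T"
      unfolding ksp by (intro image_eqI[of _ _ "((p' $ i0, s), p')"]) auto
  qed
  moreover have fin: "finite (Sigma P T)" using P finT by (intro finite_SigmaI) auto
  ultimately have "card M \<le> card (Sigma P T)" by (rule surj_card_le[rotated])
  also have "card (Sigma P T) = (\<Sum>v\<in>P. card (T v))" using P finT by (intro card_SigmaI) auto
  finally have "real (card M) \<le> (\<Sum>v\<in>P. real (card (T v)))" by (metis of_nat_le_iff of_nat_sum)
  also have "\<dots> \<le> (\<Sum>v\<in>P. (2 * (real N * d) + 2) ^ (CARD('n) - 1))"
    using cardT by (intro sum_mono) auto
  finally show ?thesis by simp
qed

end

section \<open>One step of the construction\<close>

text \<open>
  A node, a scale as in \<open>choose_scale\<close>, and fractions as in \<open>separated_fractions\<close> with denominators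
  beyond the threshold of \<open>denominator_threshold\<close>.
\<close>

locale exact_step = exact_tree \<psi> i0 b s0 t mu \<theta>
  for \<psi> :: "nat \<Rightarrow> real" and i0 :: "'n::finite" and b s0 :: nat and t mu \<theta> :: real +
  fixes k q :: nat and p :: "int ^ 'n" and N :: nat and \<delta> :: real and P :: "(int \<times> nat) set"
  assumes parent: "(k, q, p) \<in> nodes"
    and \<delta>_pos: "0 < \<delta>" and N\<delta>: "real N * \<delta> \<le> 2"
    and NN\<delta>: "256 * real b ^ 2 \<le> real N ^ 2 * \<delta>" "real N ^ 2 * \<delta> \<le> 1024 * real b ^ 2"
    and N_bounds: "16 * b * \<delta> powr (-1/2) \<le> N" "N \<le> 32 * b * \<delta> powr (-1/2)"
    and scale_small: "10 * 4 ^ (CARD('n) - 1) * 4 powr (max t 1 - 1) * \<delta> powr (growth - max t 1) \<le> scale_const k q"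
    and scale_many: "1 \<le> scale_const k q * \<delta> powr - growth * ((32 * b) powr - mu * \<delta> powr (mu / 2)) powr t"
    and finite_P: "finite P" and card_P: "(shell_length k q / \<delta>) powr \<theta> \<le> real (card P)"
    and P_frac: "\<And>r s. (r, s) \<in> P \<Longrightarrow> coprime r (int s) \<and> 1 \<le> s \<and> s \<le> N \<and> real N \<le> 64 * real b ^ 2 * s
       \<and> of_int r / of_nat s \<in> {shell_start k q p + \<delta> / 4..shell_start k q p + shell_length k q - \<delta> / 4}"
    and P_apart: "\<And>r s x r' s'. (r, s) \<in> P \<Longrightarrow> \<bar>x - of_int r / of_nat s\<bar> \<le> \<delta> / 4 \<Longrightarrow>
       1 \<le> 2 * b * shell_length k q * real s' ^ 2 \<Longrightarrow> 2 * b * \<delta> * real s' ^ 2 < 1 \<Longrightarrow>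
       1 / (4 * real b ^ 2 * real s' ^ 2) \<le> \<bar>x - of_int r' / of_nat s'\<bar>"
    and P_sep: "\<And>r s r' s'. (r, s) \<in> P \<Longrightarrow> (r', s') \<in> P \<Longrightarrow> (r, s) \<noteq> (r', s') \<Longrightarrow>
       \<delta> / 2 \<le> \<bar>of_int r / of_nat s - of_int r' / of_nat s'\<bar>"
    and P_large: "\<And>r s. (r, s) \<in> P \<Longrightarrow> s0 \<le> s \<and> q < s \<and> real s ^ 2 * \<psi> s \<le> real b * \<eta> (Suc k) / 4 \<and>
     2 * \<psi> s \<le> \<psi> q \<and> 4 \<le> real s * \<psi> q"
begin

lemma b_pos: "0 < real b" "1 \<le> real b" using b by auto

lemma N_pos: "0 < real N"
proof -
  have "0 < 16 * b * \<delta> powr (-1/2)" using b_pos \<delta>_pos by simp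
  then show ?thesis using N_bounds(1) by linarith
qed

lemma \<psi>_le_inverse_square:
  assumes "s0 \<le> s"
  shows "\<psi> s \<le> 1 / (128 * real b ^ 2 * real s ^ 2)"
  using s0(2)[OF assms] b_pos s0(1) assms by (simp add: field_simps)

lemma P_\<psi>_small:
  assumes "(r, s) \<in> P"
  shows "\<psi> s \<le> \<delta> / 8" "real s * \<psi> s \<le> 1 / 2"
proof -
  have s: "s0 \<le> s" "1 \<le> s" "real N \<le> 64 * real b ^ 2 * s" using P_large[OF assms] P_frac[OF assms] by auto
  have s1: "1 \<le> real s" using s by simp
  have b2: "1 \<le> real b ^ 2" using b_pos by simp
  have "256 * real b ^ 2 * 1 \<le> real N ^ 2 * \<delta>" using NN\<delta>(1) by simp
  also have "\<dots> \<le> (64 * real b ^ 2 * s) ^ 2 * \<delta>" using s(3) \<delta>_pos by (intro mult_right_mono power_mono) auto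
  also have "\<dots> = 256 * real b ^ 2 * (16 * real b ^ 2 * real s ^ 2 * \<delta>)"
    by (simp add: power2_eq_square)
  finally have "1 \<le> 16 * real b ^ 2 * real s ^ 2 * \<delta>"
    by (rule mult_left_le_imp_le) (use b_pos in simp)
  then have "1 / (128 * real b ^ 2 * real s ^ 2) \<le> \<delta> / 8" using b_pos s1 by (simp add: field_simps)
  then show "\<psi> s \<le> \<delta> / 8" using \<psi>_le_inverse_square[OF s(1)] by linarith
  have p: "0 \<le> real s * \<psi> s" using \<psi>_range[of s] s by auto
  have "2 * (real s * \<psi> s) = 2 * 1 * 1 * (real s * \<psi> s)" by simp
  also have "\<dots> \<le> 128 * real b ^ 2 * real s * (real s * \<psi> s)"
    using s1 b2 p by (intro mult_right_mono mult_mono) auto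
  also have "\<dots> \<le> 1" using s0(2)[OF s(1)] by (simp add: power2_eq_square mult_ac)
  finally show "real s * \<psi> s \<le> 1 / 2" by simp
qed

definition children :: "(nat \<times> nat \<times> (int ^ 'n)) set" where
  "children = child_nodes (k, q, p) P"

lemma mem_children:
  "(k', s, p') \<in> children \<longleftrightarrow> k' = Suc k \<and> (p' $ i0, s) \<in> P \<and>
     (\<forall>i. i \<noteq> i0 \<longrightarrow> \<bar>of_int (p' $ i) / of_nat s - of_int (p $ i) / of_nat q\<bar> \<le> \<psi> q / 4)"
  unfolding children_def by (rule mem_child_nodes)

lemma finite_children: "finite children"
  unfolding children_def using P_frac by (intro finite_child_nodes finite_P) blast

lemma child_in_nodes: "(k', s, p') \<in> children \<Longrightarrow> (k', s, p') \<in> nodes"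
  using P_large[of "p' $ i0" s] P_frac[of "p' $ i0" s] by (auto simp: mem_children nodes_def)

lemma child_first_coordinate:
  assumes c: "(k', s, p') \<in> children" and \<alpha>: "\<alpha> \<in> node_box (k', s, p')"
  shows "\<bar>\<alpha> $ i0 - of_int (p' $ i0) / of_nat s\<bar> < \<psi> s"
  using shell_offset(3)[OF child_in_nodes[OF c]] \<alpha> by (auto simp: mem_node_box)

lemma child_box_subset:
  assumes c: "(k', s, p') \<in> children"
  shows "node_box (k', s, p') \<subseteq> node_box (k, q, p)"
proof
  fix \<alpha> assume \<alpha>: "\<alpha> \<in> node_box (k', s, p')"
  have P: "(p' $ i0, s) \<in> P" using c by (simp add: mem_children)
  have "\<bar>\<alpha> $ i0 - of_int (p' $ i0) / of_nat s\<bar> < \<delta> / 8"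
    using child_first_coordinate[OF c \<alpha>] P_\<psi>_small(1)[OF P] by linarith
  moreover have "of_int (p' $ i0) / of_nat s \<in> {shell_start k q p + \<delta> / 4..shell_start k q p + shell_length k q - \<delta> / 4}"
    using P_frac[OF P] by blast
  ultimately have "\<alpha> $ i0 \<in> {shell_start k q p..shell_start k q p + shell_length k q}"
    using \<delta>_pos unfolding atLeastAtMost_iff by linarith
  moreover have "\<bar>\<alpha> $ i - of_int (p $ i) / of_nat q\<bar> \<le> \<psi> q / 2" if "i \<noteq> i0" for i
  proof -
    have "\<bar>\<alpha> $ i - of_int (p' $ i) / of_nat s\<bar> \<le> \<psi> s / 2" using \<alpha> that by (simp add: mem_node_box)
    moreover have "\<bar>of_int (p' $ i) / of_nat s - of_int (p $ i) / of_nat q\<bar> \<le> \<psi> q / 4"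
      using c that by (simp add: mem_children)
    moreover have "2 * \<psi> s \<le> \<psi> q" using P_large[OF P] by blast
    ultimately show ?thesis by linarith
  qed
  ultimately show "\<alpha> \<in> node_box (k, q, p)" unfolding mem_node_box by blast
qed

text \<open>
  Three ranges of denominators: the small ones are handled by the position of the shell of the parent,
  the middle ones by bad approximability, and the large ones, comparable to \<open>s\<close>, by the gap between
  different fractions together with \<open>\<psi> s' \<le> 1 / (2 s' s)\<close>.
\<close>

lemma child_avoids:
  fixes r' :: int
  assumes c: "(k', s, p') \<in> children" and \<alpha>: "\<alpha> \<in> node_box (k', s, p')" and s': "q \<le> s'" "s' < s"
  shows "(1 - \<eta> k) * \<psi> s' \<le> \<bar>\<alpha> $ i0 - of_int r' / of_nat s'\<bar>"
proof -
  have P: "(p' $ i0, s) \<in> P" using c by (simp add: mem_children)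
  note q = node_props[OF parent]
  have s1: "1 \<le> s'" "s0 \<le> s'" using s' q by auto
  have r: "0 < real s'" "0 < real s" using s1 s' by auto
  have \<psi>s': "0 < \<psi> s'" using \<psi>_range[OF s1(1)] by simp
  have weaken: "(1 - \<eta> k) * \<psi> s' \<le> \<psi> s'"
  proof -
    have "(1 - \<eta> k) * \<psi> s' \<le> 1 * \<psi> s'" using \<eta>_bounds[of k] \<psi>s' by (intro mult_right_mono) auto
    then show ?thesis by simp
  qed
  have near: "\<bar>\<alpha> $ i0 - of_int (p' $ i0) / of_nat s\<bar> < \<psi> s" by (rule child_first_coordinate[OF c \<alpha>])
  consider "2 * b * shell_length k q * real s' ^ 2 < 1"
    | "1 \<le> 2 * b * shell_length k q * real s' ^ 2" "2 * b * \<delta> * real s' ^ 2 < 1"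
    | "1 \<le> 2 * b * \<delta> * real s' ^ 2" by linarith
  then show ?thesis
  proof cases
    case 1
    have "\<alpha> $ i0 \<in> {shell_start k q p..shell_start k q p + shell_length k q}"
      using child_box_subset[OF c] \<alpha> mem_node_box[of \<alpha> k q p] by blast
    then have "(1 - \<eta> k) * \<psi> q \<le> \<bar>\<alpha> $ i0 - of_int r' / of_nat s'\<bar>"
      using shell_avoids_small_denominators[OF parent _ s1(1) 1] by blast
    moreover have "(1 - \<eta> k) * \<psi> s' \<le> (1 - \<eta> k) * \<psi> q"
      using \<psi>_anti[of q s'] s' q \<eta>_bounds[of k] by (intro mult_left_mono) auto
    ultimately show ?thesis by linarith
  next
    case 2
    have "\<bar>\<alpha> $ i0 - of_int (p' $ i0) / of_nat s\<bar> \<le> \<delta> / 4"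
      using near P_\<psi>_small(1)[OF P] \<delta>_pos by linarith
    from P_apart[OF P this 2]
    have "1 / (4 * real b ^ 2 * real s' ^ 2) \<le> \<bar>\<alpha> $ i0 - of_int r' / of_nat s'\<bar>" .
    moreover have "1 / (128 * real b ^ 2 * real s' ^ 2) \<le> 1 / (4 * real b ^ 2 * real s' ^ 2)"
      using b_pos r by (intro divide_left_mono mult_right_mono) auto
    ultimately show ?thesis using \<psi>_le_inverse_square[OF s1(2)] weaken by linarith
  next
    case 3
    have "real s ^ 2 * 1 \<le> real N ^ 2 * (2 * b * \<delta> * real s' ^ 2)"
      using 3 P_frac[OF P] by (intro mult_mono power_mono) auto
    also have "\<dots> = (real N ^ 2 * \<delta>) * (2 * b * real s' ^ 2)" by (simp add: algebra_simps)
    also have "\<dots> \<le> (1024 * real b ^ 2) * (2 * b * real s' ^ 2)" using NN\<delta>(2) by (intro mult_right_mono) auto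
    also have "\<dots> = 2048 * (real b ^ 3 * real s' ^ 2)" by (simp add: power2_eq_square power3_eq_cube)
    also have "\<dots> \<le> 4096 * (real b ^ 4 * real s' ^ 2)"
      using b_pos by (intro mult_mono power_increasing mult_right_mono) auto
    also have "\<dots> = (64 * real b ^ 2 * s') ^ 2" by (simp add: power_mult_distrib flip: power_mult)
    finally have "real s ^ 2 \<le> (64 * real b ^ 2 * s') ^ 2" by simp
    then have ss': "real s \<le> 64 * real b ^ 2 * s'" by (rule power2_le_imp_le) simp
    have "\<psi> s' \<le> 1 / (128 * real b ^ 2 * real s' ^ 2)" by (rule \<psi>_le_inverse_square[OF s1(2)])
    also have "\<dots> \<le> 1 / (2 * (real s' * real s))"
      using ss' r b_pos by (simp add: field_simps power2_eq_square)
    finally have 1: "\<psi> s' \<le> 1 / (2 * (real s' * real s))" .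
    have 2: "\<psi> s \<le> \<psi> s'" using \<psi>_anti[of s' s] s1 s' by simp
    have "of_int (p' $ i0) / of_nat s \<noteq> (of_int r' / of_nat s' :: real)"
      using P_frac[OF P] s1 s' by (intro coprime_fraction_neq) auto
    then have "1 / (real s * real s') \<le> \<bar>of_int (p' $ i0) / of_nat s - of_int r' / of_nat s'\<bar>"
      using s1 s' by (intro fraction_gap) auto
    moreover have "1 / (real s * real s') = 2 * (1 / (2 * (real s' * real s)))" by simp
    ultimately show ?thesis using near 1 2 weaken by linarith
  qed
qed

lemma child_descends: "c \<in> children \<Longrightarrow> descends (k, q, p) c"
proof -
  assume c: "c \<in> children"
  obtain k' s p' where ksp: "c = (k', s, p')" by (metis prod_cases3)
  have "(p' $ i0, s) \<in> P" "k' = Suc k" using c ksp by (simp_all add: mem_children)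
  then show ?thesis
    using c child_in_nodes[of k' s p'] child_box_subset[of k' s p'] child_avoids[of k' s p'] P_large[of "p' $ i0" s]
    unfolding descends_def ksp by simp
qed

text \<open>
  A lower bound for the number of numerators per coordinate other than \<open>i0\<close>.
\<close>

definition spread_factor :: real where
  "spread_factor = real N * \<psi> q / (256 * real b ^ 2)"

lemma spread_factor_pos: "0 < spread_factor"
  using N_pos node_props(3)[OF parent] b_pos by (simp add: spread_factor_def)

lemma card_children_ge: "real (card P) * spread_factor ^ (CARD('n) - 1) \<le> real (card children)"
  unfolding children_def
proof (rule card_child_nodes_ge[OF finite_P])
  show "0 \<le> spread_factor" using spread_factor_pos by simp
  fix r s assume rs: "(r, s) \<in> P"
  have "real N * \<psi> q \<le> 64 * real b ^ 2 * s * \<psi> q"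
    using P_frac[OF rs] node_props(3)[OF parent] by (intro mult_right_mono) auto
  then have "spread_factor \<le> real s * \<psi> q / 4" using b_pos by (simp add: spread_factor_def field_simps)
  then show "1 \<le> s \<and> 4 \<le> real s * \<psi> q \<and> spread_factor \<le> real s * \<psi> q / 4"
    using P_large[OF rs] P_frac[OF rs] by blast
qed

lemma card_children_ge_powr: "scale_const k q * \<delta> powr - growth \<le> real (card children)"
proof -
  let ?m = "CARD('n) - 1"
  note q = node_props[OF parent]
  have 1: "\<psi> q / (16 * b) * \<delta> powr (-1/2) \<le> spread_factor"
  proof -
    have "\<psi> q / (16 * b) * \<delta> powr (-1/2) = (16 * b * \<delta> powr (-1/2)) * \<psi> q / (256 * real b ^ 2)"
      using b_pos by (simp add: power2_eq_square field_simps)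
    also have "\<dots> \<le> real N * \<psi> q / (256 * real b ^ 2)"
      using N_bounds(1) q by (intro divide_right_mono mult_right_mono) auto
    finally show ?thesis by (simp add: spread_factor_def)
  qed
  have "(\<delta> powr (-1/2)) ^ ?m = \<delta> powr (-1/2 * real ?m)"
    using \<delta>_pos by (subst powr_realpow[symmetric]) (simp_all add: powr_powr)
  moreover have "\<delta> powr - growth = \<delta> powr - \<theta> * \<delta> powr (-1/2 * real ?m)"
    by (simp add: growth_def flip: powr_add)
  moreover have "(shell_length k q / \<delta>) powr \<theta> = shell_length k q powr \<theta> * \<delta> powr - \<theta>"
    using q \<delta>_pos by (simp add: powr_divide powr_minus_divide)
  ultimately have "scale_const k q * \<delta> powr - growth =
      (shell_length k q / \<delta>) powr \<theta> * (\<psi> q / (16 * b) * \<delta> powr (-1/2)) ^ ?m"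
    by (simp only: scale_const_def power_mult_distrib mult_ac)
  also have "\<dots> \<le> real (card P) * spread_factor ^ ?m"
    using 1 card_P q b_pos by (intro mult_mono power_mono) auto
  also have "\<dots> \<le> real (card children)" by (rule card_children_ge)
  finally show ?thesis .
qed

lemma children_many:
  assumes c: "(k', s, p') \<in> children"
  shows "1 \<le> real (card children) * \<psi> s powr t"
proof -
  have P: "(p' $ i0, s) \<in> P" using c by (simp add: mem_children)
  have s: "s0 \<le> s" "1 \<le> s" "s \<le> N" using P_large[OF P] P_frac[OF P] by auto
  have "(32 * b) powr - mu * \<delta> powr (mu / 2) = (32 * b * \<delta> powr (-1/2)) powr - mu"
    by (simp add: powr_mult powr_powr)
  also have "\<dots> \<le> real s powr - mu"
    using s N_bounds(2) mu by (intro powr_mono2') auto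
  also have "\<dots> \<le> \<psi> s" by (rule s0(3)[OF s(1)])
  finally have 1: "((32 * b) powr - mu * \<delta> powr (mu / 2)) powr t \<le> \<psi> s powr t"
    using t by (intro powr_mono2) auto
  have "1 \<le> scale_const k q * \<delta> powr - growth * ((32 * b) powr - mu * \<delta> powr (mu / 2)) powr t"
    by (rule scale_many)
  also have "\<dots> \<le> real (card children) * \<psi> s powr t"
    using 1 card_children_ge_powr by (intro mult_mono) auto
  finally show ?thesis .
qed

lemma children_nonempty: "children \<noteq> {}"
proof
  assume "children = {}"
  then have "scale_const k q * \<delta> powr - growth \<le> 0" using card_children_ge_powr by simp
  then have "scale_const k q * \<delta> powr - growth * ((32 * b) powr - mu * \<delta> powr (mu / 2)) powr t \<le> 0"
    by (rule mult_nonpos_nonneg) simp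
  then show False using scale_many by linarith
qed

text \<open>
  Children over different fractions in coordinate \<open>i0\<close> are separated there by the order of \<open>\<delta>\<close>.
  Children over the same fraction differ in another coordinate by at least \<open>1 / s\<close>, which is larger.
\<close>

lemma two_children_met:
  assumes U: "\<And>x y. x \<in> U \<Longrightarrow> y \<in> U \<Longrightarrow> dist x y \<le> d"
    and c: "c1 \<in> children" "c2 \<in> children" "c1 \<noteq> c2" "node_box c1 \<inter> U \<noteq> {}" "node_box c2 \<inter> U \<noteq> {}"
  shows "\<delta> / 4 \<le> d"
proof -
  obtain k1 s1 p1 k2 s2 p2 where eq: "c1 = (k1, s1, p1)" "c2 = (k2, s2, p2)" by (metis prod_cases3)
  obtain u1 u2 where u: "u1 \<in> node_box c1" "u2 \<in> node_box c2" "u1 \<in> U" "u2 \<in> U" using c by blast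
  have P: "(p1 $ i0, s1) \<in> P" "(p2 $ i0, s2) \<in> P" and kk: "k1 = k2"
    using c eq by (simp_all add: mem_children)
  have coord: "\<bar>u1 $ i - u2 $ i\<bar> \<le> d" for i
    using U[OF u(3,4)] dist_vec_nth_le[of u1 i u2] by (simp add: dist_real_def)
  show ?thesis
  proof (cases "(p1 $ i0, s1) = (p2 $ i0, s2)")
    case False
    have "\<bar>u1 $ i0 - of_int (p1 $ i0) / of_nat s1\<bar> < \<delta> / 8" "\<bar>u2 $ i0 - of_int (p2 $ i0) / of_nat s2\<bar> < \<delta> / 8"
      using child_first_coordinate[of k1 s1 p1 u1] child_first_coordinate[of k2 s2 p2 u2] c(1,2) u(1,2)
        P_\<psi>_small(1)[OF P(1)] P_\<psi>_small(1)[OF P(2)] unfolding eq by linarith+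
    then show ?thesis using P_sep[OF P False] coord[of i0] by linarith
  next
    case True
    then have s: "s1 = s2" by simp
    have "p1 \<noteq> p2" using c(3) kk s unfolding eq by auto
    then obtain i where i: "p1 $ i \<noteq> p2 $ i" by (auto simp: vec_eq_iff)
    then have i0: "i \<noteq> i0" using True by auto
    have s1: "0 < real s1" "s1 \<le> N" using P_frac[OF P(1)] by auto
    have "1 \<le> \<bar>p1 $ i - p2 $ i\<bar>" using i by linarith
    then have "(1::real) \<le> \<bar>of_int (p1 $ i) - of_int (p2 $ i)\<bar>"
      by (metis of_int_1_le_iff of_int_abs of_int_diff)
    then have "1 / real s1 \<le> \<bar>of_int (p1 $ i) - of_int (p2 $ i)\<bar> / real s1"
      using s1 by (intro divide_right_mono) auto
    also have "\<dots> = \<bar>of_int (p1 $ i) / of_nat s1 - of_int (p2 $ i) / of_nat s2\<bar>"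
      using s1 by (simp add: s flip: diff_divide_distrib)
    finally have a: "1 / real s1 \<le> \<bar>of_int (p1 $ i) / of_nat s1 - of_int (p2 $ i) / of_nat s2\<bar>" .
    have h: "\<bar>u1 $ i - of_int (p1 $ i) / of_nat s1\<bar> \<le> \<psi> s1 / 2" "\<bar>u2 $ i - of_int (p2 $ i) / of_nat s2\<bar> \<le> \<psi> s1 / 2"
      using u(1,2) i0 unfolding eq mem_node_box s by blast+
    have "2 * \<psi> s1 \<le> 1 / real s1" using P_\<psi>_small(2)[OF P(1)] s1 by (simp add: field_simps)
    then have "1 / real s1 \<le> 2 * d" using a h coord[of i] by linarith
    moreover have "1 / real N \<le> 1 / real s1" using s1 by (intro divide_left_mono) auto
    moreover have "\<delta> \<le> 2 * (1 / real N)" using N\<delta> N_pos by (simp add: field_simps)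
    ultimately show ?thesis by linarith
  qed
qed

lemma card_met_le:
  assumes d: "0 < d" "\<delta> / 4 \<le> d" and U: "\<And>x y. x \<in> U \<Longrightarrow> y \<in> U \<Longrightarrow> dist x y \<le> d"
    and M: "M = {c \<in> children. node_box c \<inter> U \<noteq> {}}" and u: "u \<in> U"
  shows "real (card M) \<le> real (card P) * (2 * (real N * d) + 2) ^ (CARD('n) - 1)"
    and "real (card M) \<le> 10 * d / \<delta> * (2 * (real N * d) + 2) ^ (CARD('n) - 1)"
proof -
  define P' where "P' = {(r, s) \<in> P. \<bar>of_int r / of_nat s - u $ i0\<bar> \<le> d + \<delta> / 8}"
  have sub: "P' \<subseteq> P" by (auto simp: P'_def)
  have fin: "finite P'" using sub finite_P by (rule finite_subset)
  have "real (card M) \<le> real (card P') * (2 * (real N * d) + 2) ^ (CARD('n) - 1)"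
  proof (rule card_nodes_near_point[where k = "Suc k" and u = u, OF fin])
    show "0 \<le> d" using d by simp
    fix r s assume "(r, s) \<in> P'"
    then show "1 \<le> s \<and> s \<le> N \<and> real s * \<psi> s \<le> 1"
      using sub P_frac[of r s] P_\<psi>_small(2)[of r s] by fastforce
  next
    fix k' s p' assume "(k', s, p') \<in> M"
    then obtain x where x: "x \<in> node_box (k', s, p')" "x \<in> U" and c: "(k', s, p') \<in> children" by (auto simp: M)
    have P: "(p' $ i0, s) \<in> P" using c by (simp add: mem_children)
    have coord: "\<bar>x $ i - u $ i\<bar> \<le> d" for i
      using U[OF x(2) u] dist_vec_nth_le[of x i u] by (simp add: dist_real_def)
    have "\<bar>of_int (p' $ i0) / of_nat s - u $ i0\<bar> \<le> d + \<delta> / 8"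
      using child_first_coordinate[OF c x(1)] P_\<psi>_small(1)[OF P] coord[of i0] by linarith
    moreover have "\<bar>of_int (p' $ i) / of_nat s - u $ i\<bar> \<le> d + \<psi> s / 2" if "i \<noteq> i0" for i
    proof -
      have "\<bar>x $ i - of_int (p' $ i) / of_nat s\<bar> \<le> \<psi> s / 2" using x(1) that unfolding mem_node_box by blast
      then show ?thesis using coord[of i] by linarith
    qed
    ultimately show "k' = Suc k \<and> (p' $ i0, s) \<in> P' \<and>
        (\<forall>i. i \<noteq> i0 \<longrightarrow> \<bar>of_int (p' $ i) / of_nat s - u $ i\<bar> \<le> d + \<psi> s / 2)"
      using c P by (simp add: P'_def mem_children)
  qed
  moreover have "real (card P') \<le> real (card P)" using sub finite_P by (simp add: card_mono)
  moreover have "real (card P') \<le> 10 * d / \<delta>"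
  proof -
    have "real (card P') \<le> 2 * (d + \<delta> / 8) / (\<delta> / 2) + 1"
      by (rule card_separated_le[where f = "\<lambda>(r, s). of_int r / of_nat s" and y = "u $ i0"])
         (use \<delta>_pos d P_sep in \<open>auto simp: P'_def\<close>)
    also have "\<dots> \<le> 10 * d / \<delta>" using d \<delta>_pos by (simp add: field_simps)
    finally show ?thesis .
  qed
  moreover have "0 \<le> (2 * (real N * d) + 2) ^ (CARD('n) - 1)" using d by simp
  ultimately show "real (card M) \<le> real (card P) * (2 * (real N * d) + 2) ^ (CARD('n) - 1)"
    "real (card M) \<le> 10 * d / \<delta> * (2 * (real N * d) + 2) ^ (CARD('n) - 1)"
    by (meson mult_right_mono order_trans)+
qed

text \<open>
  Above the scale \<open>1 / N\<close> coordinate \<open>i0\<close> is ignored: the other \<open>n - 1\<close> coordinates suffice because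
  \<open>t \<le> n - 1\<close>.
\<close>

lemma spread_coarse:
  assumes d: "0 < d" "1 \<le> real N * d" and M: "M \<subseteq> children"
    and le: "real (card M) \<le> real (card P) * (2 * (real N * d) + 2) ^ (CARD('n) - 1)"
  shows "real (card M) \<le> (1024 * real b ^ 2) powr t * (d / \<psi> q) powr t * real (card children)"
proof -
  let ?m = "CARD('n) - 1"
  note q = node_props[OF parent]
  define X where "X = 1024 * real b ^ 2 * (d / \<psi> q)"
  have X: "0 < X" using d q b_pos by (simp add: X_def)
  have "real (card P) * (2 * (real N * d) + 2) ^ ?m \<le> real (card P) * (4 * (real N * d)) ^ ?m"
  proof -
    have "2 * (real N * d) + 2 \<le> 4 * (real N * d)" using d by linarith
    then show ?thesis by (intro mult_left_mono power_mono) (use d in auto)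
  qed
  also have "4 * (real N * d) = spread_factor * X" using q b_pos by (simp add: spread_factor_def X_def)
  also have "real (card P) * (spread_factor * X) ^ ?m = real (card P) * spread_factor ^ ?m * X ^ ?m"
    by (simp add: power_mult_distrib)
  also have "\<dots> \<le> real (card children) * X ^ ?m"
    using X by (intro mult_right_mono card_children_ge) auto
  finally have 1: "real (card M) \<le> real (card children) * X ^ ?m" using le by linarith
  have 2: "real (card M) \<le> real (card children) * 1" using M finite_children by (simp add: card_mono)
  have "real (card M) \<le> real (card children) * min 1 (X ^ ?m)" using 1 2 by (simp add: min_def)
  also have "\<dots> \<le> real (card children) * X powr t"
    using t X by (intro mult_left_mono min_1_power_le_powr) auto
  also have "X powr t = (1024 * real b ^ 2) powr t * (d / \<psi> q) powr t"
    using d q b_pos by (simp only: X_def powr_mult)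
  finally show ?thesis by (simp add: mult_ac)
qed

text \<open>
  Below the scale \<open>1 / N\<close> each fraction in coordinate \<open>i0\<close> carries at most \<open>4 ^ (n - 1)\<close> children
  that are met. The factor \<open>\<delta> powr (growth - max t 1)\<close> absorbs the constants, and the rest is
  compared with \<open>d powr t\<close> by \<open>\<delta> \<le> 4 d\<close>. The maximum with \<open>1\<close> is there because that comparison
  uses a nonnegative power of \<open>\<delta>\<close>.
\<close>

lemma spread_fine:
  assumes d: "0 < d" "\<delta> / 4 \<le> d" "real N * d < 1"
    and le: "real (card M) \<le> 10 * d / \<delta> * (2 * (real N * d) + 2) ^ (CARD('n) - 1)"
  shows "real (card M) \<le> (1024 * real b ^ 2) powr t * (d / \<psi> q) powr t * real (card children)"
proof -
  let ?m = "CARD('n) - 1" and ?e = "max t 1"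
  note q = node_props[OF parent]
  have N1: "1 \<le> real N" using N_pos by simp
  have "d * 1 \<le> d * real N" using N1 d by (intro mult_left_mono) auto
  then have d1: "d \<le> 1" using d(3) by (simp add: mult.commute)
  have "real (card M) \<le> 10 * d / \<delta> * 4 ^ ?m"
  proof -
    have "(2 * (real N * d) + 2) ^ ?m \<le> 4 ^ ?m" using d by (intro power_mono) auto
    then show ?thesis using le d \<delta>_pos by (meson mult_left_mono order_trans divide_nonneg_nonneg less_imp_le mult_nonneg_nonneg zero_le_numeral)
  qed
  also have "\<dots> = 10 * 4 ^ ?m * d * \<delta> powr -1" using \<delta>_pos by (simp add: powr_minus divide_inverse)
  also have "\<delta> powr -1 = \<delta> powr - growth * (\<delta> powr (growth - ?e) * \<delta> powr (?e - 1))"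
    by (simp flip: powr_add)
  also have "10 * 4 ^ ?m * d * (\<delta> powr - growth * (\<delta> powr (growth - ?e) * \<delta> powr (?e - 1))) \<le>
      10 * 4 ^ ?m * d * (\<delta> powr - growth * (\<delta> powr (growth - ?e) * (4 * d) powr (?e - 1)))"
    using d \<delta>_pos by (intro mult_left_mono powr_mono2) auto
  also have "\<dots> = (10 * 4 ^ ?m * 4 powr (?e - 1) * \<delta> powr (growth - ?e)) * \<delta> powr - growth * (d * d powr (?e - 1))"
    by (simp add: powr_mult mult_ac)
  also have "\<dots> \<le> scale_const k q * \<delta> powr - growth * (d * d powr (?e - 1))"
    using scale_small d by (intro mult_right_mono) auto
  also have "\<dots> \<le> scale_const k q * \<delta> powr - growth * d powr t"
  proof -
    have "0 \<le> scale_const k q" using q b_pos by (simp add: scale_const_def)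
    moreover have "d * d powr (?e - 1) = d powr ?e" using d by (simp add: powr_mult_base)
    moreover have "d powr ?e \<le> d powr t" using d d1 by (intro powr_mono') auto
    ultimately show ?thesis by (intro mult_left_mono) auto
  qed
  also have "scale_const k q * \<delta> powr - growth * d powr t \<le> real (card children) * (d / \<psi> q) powr t"
  proof -
    have "d powr t \<le> (d / \<psi> q) powr t" using d q t by (intro powr_mono2) (auto simp: field_simps)
    then show ?thesis using card_children_ge_powr by (intro mult_mono) auto
  qed
  also have "\<dots> \<le> (1024 * real b ^ 2) powr t * (real (card children) * (d / \<psi> q) powr t)"
  proof -
    have "1 * 1 \<le> 1024 * real b ^ 2" using b_pos by (intro mult_mono) auto
    then have "1 \<le> (1024 * real b ^ 2) powr t" using t by (intro ge_one_powr_ge_zero) auto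
    then have "1 * (real (card children) * (d / \<psi> q) powr t) \<le>
        (1024 * real b ^ 2) powr t * (real (card children) * (d / \<psi> q) powr t)"
      by (intro mult_right_mono) auto
    then show ?thesis by simp
  qed
  finally show ?thesis by (simp add: mult_ac)
qed

lemma children_spread:
  assumes d: "0 < d" and U: "\<And>x y. x \<in> U \<Longrightarrow> y \<in> U \<Longrightarrow> dist x y \<le> d"
  shows "card {c \<in> children. node_box c \<inter> U \<noteq> {}} \<le> 1 \<or>
    real (card {c \<in> children. node_box c \<inter> U \<noteq> {}}) \<le> (1024 * real b ^ 2) powr t * (d / \<psi> q) powr t * real (card children)"
proof -
  define M where "M = {c \<in> children. node_box c \<inter> U \<noteq> {}}"
  have "real (card M) \<le> (1024 * real b ^ 2) powr t * (d / \<psi> q) powr t * real (card children)" if M1: "\<not> card M \<le> 1"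
  proof -
    have "finite M" using finite_children by (simp add: M_def)
    then obtain c1 c2 where c: "c1 \<in> M" "c2 \<in> M" "c1 \<noteq> c2"
      using M1 card_le_Suc0_iff_eq[of M] One_nat_def by metis
    then have dd: "\<delta> / 4 \<le> d" using two_children_met[OF U _ _ c(3)] by (auto simp: M_def)
    obtain u where u: "u \<in> U" using c(1) by (auto simp: M_def)
    note le = card_met_le[OF d dd U M_def u]
    show ?thesis
    proof (cases "1 \<le> real N * d")
      case True
      then show ?thesis using spread_coarse[OF d _ _ le(1)] by (auto simp: M_def)
    next
      case False
      then show ?thesis using spread_fine[OF d dd _ le(2)] by auto
    qed
  qed
  then show ?thesis unfolding M_def by blast
qed

end

section \<open>The lower bound\<close>

context exact_tree
begin

definition good_children :: "nat \<times> nat \<times> (int ^ 'n) \<Rightarrow> (nat \<times> nat \<times> (int ^ 'n)) set \<Rightarrow> bool" where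
  "good_children v C \<longleftrightarrow> finite C \<and> C \<noteq> {} \<and>
    (\<forall>c\<in>C. descends v c \<and> 1 \<le> real (card C) * node_size c powr t) \<and>
    (\<forall>U d. 0 < d \<longrightarrow> (\<forall>x\<in>U. \<forall>y\<in>U. dist x y \<le> d) \<longrightarrow>
      card {c \<in> C. node_box c \<inter> U \<noteq> {}} \<le> 1 \<or>
      real (card {c \<in> C. node_box c \<inter> U \<noteq> {}}) \<le> (1024 * real b ^ 2) powr t * (d / node_size v) powr t * real (card C))"

lemma ex_good_children:
  assumes "v \<in> nodes"
  shows "\<exists>C. good_children v C"
proof -
  obtain k q p where kqp: "v = (k, q, p)" by (metis prod_cases3)
  have v: "(k, q, p) \<in> nodes" using assms kqp by simp
  note v' = node_props[OF v]
  define \<kappa> where "\<kappa> = (1 - \<eta> k) * \<psi> q"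
  have \<kappa>: "0 < \<kappa>" using \<eta>_bounds[of k] v' by (simp add: \<kappa>_def)
  obtain T where T: "\<And>s. T \<le> s \<Longrightarrow> s0 \<le> s \<and> q < s \<and> real s ^ 2 * \<psi> s \<le> real b * \<eta> (Suc k) / 4 \<and>
     2 * \<psi> s \<le> \<psi> q \<and> 4 \<le> real s * \<psi> q" using denominator_threshold[OF v] by blast
  obtain j N \<delta> where \<delta>: "\<delta> = shell_length k q / b ^ j" "0 < \<delta>" "1 < \<kappa> * N"
    "64 * real b ^ 2 * real T \<le> N" "real N * \<delta> \<le> 2"
    "256 * real b ^ 2 \<le> real N ^ 2 * \<delta>" "real N ^ 2 * \<delta> \<le> 1024 * real b ^ 2"
    "16 * b * \<delta> powr (-1/2) \<le> N" "N \<le> 32 * b * \<delta> powr (-1/2)"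
    "10 * 4 ^ (CARD('n) - 1) * 4 powr (max t 1 - 1) * \<delta> powr (growth - max t 1) \<le> scale_const k q"
    "1 \<le> scale_const k q * \<delta> powr - growth * ((32 * b) powr - mu * \<delta> powr (mu / 2)) powr t"
    by (rule choose_scale[OF v \<kappa>, of T])
  have far: "\<kappa> \<le> \<bar>x - of_int r / of_nat s\<bar>"
    if "x \<in> {shell_start k q p..shell_start k q p + shell_length k q}" "1 \<le> s"
      "2 * b * shell_length k q * real s ^ 2 < 1" for x s and r :: int
    unfolding \<kappa>_def by (rule shell_avoids_small_denominators[OF v that])
  obtain P :: "(int \<times> nat) set" where P: "finite P" "(b - 3) ^ j \<le> card P"
    "\<And>r s. (r, s) \<in> P \<Longrightarrow> coprime r (int s) \<and> 1 \<le> s \<and> s \<le> N \<and> real N \<le> 64 * real b ^ 2 * s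
       \<and> of_int r / of_nat s \<in> {shell_start k q p + \<delta> / 4..shell_start k q p + shell_length k q - \<delta> / 4}"
    "\<And>r s x r' s'. (r, s) \<in> P \<Longrightarrow> \<bar>x - of_int r / of_nat s\<bar> \<le> \<delta> / 4 \<Longrightarrow>
       1 \<le> 2 * b * shell_length k q * real s' ^ 2 \<Longrightarrow> 2 * b * \<delta> * real s' ^ 2 < 1 \<Longrightarrow>
       1 / (4 * real b ^ 2 * real s' ^ 2) \<le> \<bar>x - of_int r' / of_nat s'\<bar>"
    "\<And>r s r' s'. (r, s) \<in> P \<Longrightarrow> (r', s') \<in> P \<Longrightarrow> (r, s) \<noteq> (r', s') \<Longrightarrow>
       \<delta> / 2 \<le> \<bar>of_int r / of_nat s - of_int r' / of_nat s'\<bar>"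
    by (rule separated_fractions[OF v'(7) b \<kappa> \<delta>(3) \<delta>(1) \<delta>(6) \<delta>(7) far]) blast+
  have "(shell_length k q / \<delta>) powr \<theta> = (real b ^ j) powr \<theta>"
    using v' \<delta>(1) b by simp
  also have "\<dots> = (real b powr \<theta>) ^ j"
    using b by (simp add: powr_powr mult.commute flip: powr_realpow)
  also have "\<dots> = real ((b - 3) ^ j)" by (simp only: \<theta>(2) of_nat_power)
  also have "\<dots> \<le> real (card P)" using P(2) by (simp only: of_nat_le_iff)
  finally have card_P: "(shell_length k q / \<delta>) powr \<theta> \<le> real (card P)" .
  have large: "T \<le> s" if "(r, s) \<in> P" for r s
  proof -
    have "64 * real b ^ 2 * real T \<le> 64 * real b ^ 2 * real s" using P(3)[OF that] \<delta>(4) by linarith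
    then show ?thesis using b by simp
  qed
  interpret exact_step \<psi> i0 b s0 t mu \<theta> k q p N \<delta> P
  proof unfold_locales
    show "(k, q, p) \<in> nodes" by (rule v)
    show "0 < \<delta>" "real N * \<delta> \<le> 2" "256 * real b ^ 2 \<le> real N ^ 2 * \<delta>"
      "real N ^ 2 * \<delta> \<le> 1024 * real b ^ 2" "16 * b * \<delta> powr (-1/2) \<le> N" "N \<le> 32 * b * \<delta> powr (-1/2)"
      "10 * 4 ^ (CARD('n) - 1) * 4 powr (max t 1 - 1) * \<delta> powr (growth - max t 1) \<le> scale_const k q"
      "1 \<le> scale_const k q * \<delta> powr - growth * ((32 * b) powr - mu * \<delta> powr (mu / 2)) powr t"
      by (fact \<delta>)+
    show "finite P" "(shell_length k q / \<delta>) powr \<theta> \<le> real (card P)" by (fact P(1) card_P)+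
  qed (fact P(3) P(4) P(5) T[OF large])+
  have "good_children v children"
    unfolding good_children_def kqp
  proof (intro conjI ballI allI impI finite_children children_nonempty child_descends)
    fix c assume c: "c \<in> children"
    obtain k' s p' where ksp: "c = (k', s, p')" by (metis prod_cases3)
    show "1 \<le> real (card children) * node_size c powr t" using children_many[of k' s p'] c ksp by simp
  next
    fix U :: "(real ^ 'n) set" and d :: real assume "0 < d" "\<forall>x\<in>U. \<forall>y\<in>U. dist x y \<le> d"
    then show "card {c \<in> children. node_box c \<inter> U \<noteq> {}} \<le> 1 \<or>
      real (card {c \<in> children. node_box c \<inter> U \<noteq> {}})
        \<le> (1024 * real b ^ 2) powr t * (d / node_size (k, q, p)) powr t * real (card children)"
      using children_spread[of d U] by simp
  qed
  then show ?thesis by blast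
qed

lemma root_exists:
  obtains q0 where "(0, q0, \<chi> i. 1) \<in> nodes"
proof -
  have "\<forall>\<^sub>F q in sequentially. real q ^ 2 * \<psi> q < real b * \<eta> 0 / 4"
    using \<eta>_bounds[of 0] b by (intro order_tendstoD(2)[OF \<psi>_lim]) auto
  from eventually_happens'[OF _ eventually_conj[OF this eventually_ge_at_top[of s0]]]
  obtain q where "real q ^ 2 * \<psi> q < real b * \<eta> 0 / 4" "s0 \<le> q" by auto
  then have "(0, q, \<chi> i. 1) \<in> nodes" by (simp add: nodes_def)
  then show ?thesis by (rule that)
qed

lemma node_box_near:
  assumes "(k, q, p) \<in> nodes" "\<alpha> \<in> node_box (k, q, p)"
  shows "\<bar>\<alpha> $ i - of_int (p $ i) / of_nat q\<bar> < \<psi> q"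
proof (cases "i = i0")
  case True
  then show ?thesis using shell_offset(3)[OF assms(1)] assms(2) by (simp add: mem_node_box)
next
  case False
  then have "\<bar>\<alpha> $ i - of_int (p $ i) / of_nat q\<bar> \<le> \<psi> q / 2" using assms(2) unfolding mem_node_box by blast
  then show ?thesis using node_props(3)[OF assms(1)] by linarith
qed

lemma root_box_in_unit_cube:
  assumes v: "(0, q, \<chi> i. 1) \<in> nodes" and \<alpha>: "\<alpha> \<in> node_box (0, q, \<chi> i. 1)"
  shows "\<alpha> $ i \<in> {0..1}"
proof -
  note v' = node_props[OF v]
  have "1 * 1 * 1 * (real q * \<psi> q) \<le> 128 * real b ^ 2 * real q * (real q * \<psi> q)"
    using v' b by (intro mult_right_mono mult_mono) auto
  also have "\<dots> \<le> 1" using s0(2)[OF v'(2)] by (simp add: power2_eq_square mult_ac)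
  finally have "\<psi> q \<le> 1 / q" using v' by (simp add: field_simps)
  moreover have "1 / q \<le> 1 / (2::real)" using v'(1) by (intro divide_left_mono) auto
  moreover have "\<bar>\<alpha> $ i - 1 / q\<bar> < \<psi> q" using node_box_near[OF v \<alpha>, of i] by simp
  ultimately show ?thesis unfolding atLeastAtMost_iff by linarith
qed

text \<open>
  A denominator \<open>s\<close> lies between consecutive denominators of the path, say at level \<open>k\<close>. There
  coordinate \<open>i0\<close> keeps the distance \<open>(1 - \<eta> k) * \<psi> s\<close>, which exceeds \<open>c * \<psi> s\<close> for large \<open>k\<close>.
\<close>

lemma path_exactly_approximable:
  assumes f0: "f 0 = (0, q0, \<chi> i. 1)" and nodes: "\<And>k. f k \<in> nodes"
    and desc: "\<And>k. descends (f k) (f (Suc k))" and box: "\<And>k. \<alpha> \<in> node_box (f k)"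
  shows "\<alpha> \<in> exactly_approximable \<psi>"
proof -
  define Q where "Q = (\<lambda>k. fst (snd (f k)))"
  define p where "p = (\<lambda>k. snd (snd (f k)))"
  have step: "fst (f (Suc k)) = Suc (fst (f k))" for k
    using desc[of k] by (auto simp: descends_def split: prod.splits)
  have fst_f: "fst (f k) = k" for k by (induction k) (simp_all add: f0 step)
  have f: "f k = (k, Q k, p k)" for k
    by (metis fst_f Q_def p_def prod.collapse)
  have v: "(k, Q k, p k) \<in> nodes" for k using nodes[of k] by (simp add: f)
  have near: "\<bar>\<alpha> $ i - of_int (p k $ i) / of_nat (Q k)\<bar> < \<psi> (Q k)" for k i
    using node_box_near[OF v] box[of k] by (simp add: f)
  have Q_step: "Q k < Q (Suc k)" for k using desc[of k] by (simp add: descends_def f)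
  have mono: "strict_mono Q" using Q_step by (rule strict_monoI_Suc)
  have avoid: "(1 - \<eta> k) * \<psi> s \<le> \<bar>\<alpha> $ i0 - of_int r / of_nat s\<bar>" if "Q k \<le> s" "s < Q (Suc k)" for k s and r :: int
    using desc[of k] box[of "Suc k"] that by (simp add: descends_def f)
  have cube: "\<alpha> $ i \<in> {0..1}" for i
    using root_box_in_unit_cube[of q0 \<alpha> i] nodes[of 0] box[of 0] by (simp add: f0)
  have W: "\<alpha> \<in> well_approximable \<psi>"
  proof -
    have "range (\<lambda>k. (Q k, p k)) \<subseteq> {(q :: nat, p :: int ^ 'n).
            1 \<le> q \<and> (MAX i. \<bar>\<alpha> $ i - of_int (p $ i) / of_nat q\<bar>) < \<psi> q}"
      using near node_props(1)[OF v] by (auto simp: Max_UNIV_less_iff intro: le_trans[of _ 2])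
    moreover have "inj (\<lambda>k. (Q k, p k))"
      using strict_mono_eq[OF mono] by (auto intro!: injI)
    ultimately have "infinite {(q :: nat, p :: int ^ 'n).
            1 \<le> q \<and> (MAX i. \<bar>\<alpha> $ i - of_int (p $ i) / of_nat q\<bar>) < \<psi> q}"
      using infinite_super range_inj_infinite by blast
    then show ?thesis using cube by (simp add: well_approximable_def)
  qed
  have "\<alpha> \<notin> well_approximable (\<lambda>q. c * \<psi> q)" if c: "0 < c" "c < 1" for c
  proof
    assume \<alpha>: "\<alpha> \<in> well_approximable (\<lambda>q. c * \<psi> q)"
    obtain k0 :: nat where k0: "1 / (1 - c) < real k0" using reals_Archimedean2 by blast
    have \<eta>_small: "c < 1 - \<eta> k" if "k0 \<le> k" for k
    proof -
      have "1 / (1 - c) < real k + 2" using k0 that by linarith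
      then have "1 < (1 - c) * (real k + 2)" using c by (simp add: field_simps)
      then show ?thesis by (simp add: \<eta>_def field_simps)
    qed
    have "c * \<psi> q \<le> 1" if "1 \<le> q" for q
      using c \<psi>_range[OF that] mult_mono[of c 1 "\<psi> q" 1] by simp
    then obtain s r where s: "Q k0 \<le> s" "\<alpha> \<in> cube_about (\<lambda>q. c * \<psi> q) s r"
      using well_approximable_in_cubes[of "\<lambda>q. c * \<psi> q" \<alpha> "Q k0"] \<alpha> by blast
    have ex: "s < Q (Suc s)" using strict_mono_imp_increasing[OF mono, of "Suc s"] by linarith
    \<comment> \<open>The level \<open>k\<close> is the last one whose denominator does not exceed \<open>s\<close>.\<close>
    define j where "j = (LEAST j. s < Q j)"
    have j: "s < Q j" unfolding j_def using ex by (rule LeastI)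
    have j': "Q i \<le> s" if "i < j" for i
      using not_less_Least[of i "\<lambda>j. s < Q j"] that unfolding j_def not_less .
    have "k0 < j" using j s(1) strict_mono_less[OF mono, of k0 j] by linarith
    then obtain k where k: "j = Suc k" "k0 \<le> k" by (cases j) auto
    have "1 \<le> s" using s(1) node_props(1)[OF v[of k0]] by linarith
    then have "0 < \<psi> s" using \<psi>_range[of s] by simp
    then have "c * \<psi> s < (1 - \<eta> k) * \<psi> s" using \<eta>_small[OF k(2)] by (intro mult_strict_right_mono)
    also have "\<dots> \<le> \<bar>\<alpha> $ i0 - of_int (r $ i0) / of_nat s\<bar>" using j j' k by (intro avoid) auto
    also have "\<dots> < c * \<psi> s" using s(2) by (simp add: cube_about_def)
    finally show False .
  qed
  then show ?thesis using W by (auto simp: exactly_approximable_def)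
qed

lemma hausdorff_measure_exactly_approximable:
  "hausdorff_measure t (exactly_approximable \<psi> :: (real ^ 'n) set) \<noteq> 0"
proof -
  define ch where "ch = (\<lambda>v. SOME C. good_children v C)"
  have good: "good_children v (ch v)" if "v \<in> nodes" for v
    unfolding ch_def using ex_good_children[OF that] by (rule someI_ex)
  have desc: "descends v c" if "v \<in> nodes" "c \<in> ch v" for v c
    using good[OF that(1)] that(2) by (simp add: good_children_def)
  interpret mass_tree nodes ch node_box node_size "(1024 * real b ^ 2) powr t" t
  proof
    show "0 < t" by (rule t)
    have "1 * 1 \<le> 1024 * real b ^ 2" using b by (intro mult_mono) auto
    then show "1 \<le> (1024 * real b ^ 2) powr t" using t by (intro ge_one_powr_ge_zero) auto
  next
    fix v assume v: "v \<in> nodes"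
    obtain k q p where kqp: "v = (k, q, p)" by (metis prod_cases3)
    note v' = node_props[OF v[unfolded kqp]]
    show "ch v \<subseteq> nodes" using desc[OF v] by (auto simp: descends_def split: prod.splits)
    show "finite (ch v)" "ch v \<noteq> {}" using good[OF v] by (simp_all add: good_children_def)
    show "compact (node_box v)" unfolding kqp node_box.simps by (rule compact_cbox)
    have "(\<chi> i. if i = i0 then shell_start k q p else of_int (p $ i) / of_nat q) \<in> node_box v"
      using v' by (simp add: kqp mem_node_box)
    then show "node_box v \<noteq> {}" by blast
    show "0 < node_size v" "node_size v \<le> 1" using v' by (simp_all add: kqp)
  next
    fix v c assume v: "v \<in> nodes" and c: "c \<in> ch v"
    show "node_box c \<subseteq> node_box v" "2 * node_size c \<le> node_size v"
      using desc[OF v c] by (auto simp: descends_def split: prod.splits)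
    show "1 \<le> real (card (ch v)) * node_size c powr t"
      using good[OF v] c by (simp add: good_children_def)
  next
    fix v and U :: "(real ^ 'n) set" and d :: real
    assume "v \<in> nodes" "0 < d" "\<And>x y. x \<in> U \<Longrightarrow> y \<in> U \<Longrightarrow> dist x y \<le> d"
    then show "card {c \<in> ch v. node_box c \<inter> U \<noteq> {}} \<le> 1 \<or>
        real (card {c \<in> ch v. node_box c \<inter> U \<noteq> {}})
          \<le> (1024 * real b ^ 2) powr t * (d / node_size v) powr t * real (card (ch v))"
      using good[of v] by (simp add: good_children_def)
  qed
  obtain q0 where root: "(0, q0, \<chi> i. 1) \<in> nodes" by (rule root_exists)
  have "limit_set (0, q0, \<chi> i. 1) \<subseteq> exactly_approximable \<psi>"
  proof
    fix \<alpha> assume "\<alpha> \<in> limit_set (0, q0, \<chi> i. 1)"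
    from limit_set_path[OF root this] obtain f where
      f: "f 0 = (0, q0, \<chi> i. 1)" "\<And>k. f k \<in> nodes" "\<And>k. f (Suc k) \<in> ch (f k)" "\<And>k. \<alpha> \<in> node_box (f k)"
      by blast
    show "\<alpha> \<in> exactly_approximable \<psi>"
      using f desc by (intro path_exactly_approximable[of f q0 \<alpha>]) auto
  qed
  then show ?thesis
    using hausdorff_measure_mono_set[of _ _ t] hausdorff_measure_limit_set[OF root]
    by (metis le_zero_eq)
qed

end

text \<open>
  Discarding three of \<open>b\<close> parts costs little in the exponent when \<open>b\<close> is large.
\<close>

lemma branching_exponent_exists:
  fixes e :: real
  assumes "e < 1"
  obtains b :: nat and \<theta> :: real where "4 \<le> b" "0 < \<theta>" "real b powr \<theta> = real (b - 3)" "e < \<theta>"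
proof -
  have "((\<lambda>b::nat. ln (real b - 3) / ln (real b)) \<longlongrightarrow> 1) sequentially" by real_asymp
  then have "\<forall>\<^sub>F b::nat in sequentially. max 0 e < ln (real b - 3) / ln (real b)"
    using assms by (intro order_tendstoD) auto
  from eventually_happens'[OF _ eventually_conj[OF this eventually_ge_at_top[of 4]]]
  obtain b :: nat where b: "max 0 e < ln (real b - 3) / ln (real b)" "4 \<le> b" by auto
  have "real b powr (ln (real b - 3) / ln (real b)) = real (b - 3)"
    using b(2) by (simp add: powr_def of_nat_diff)
  then show ?thesis using b by (intro that[of b "ln (real b - 3) / ln (real b)"]) auto
qed

lemma hausdorff_measure_exactly_approximable_ne_0:
  fixes \<psi> :: "nat \<Rightarrow> real" and lam u :: real
  assumes \<psi>: "\<And>q. 1 \<le> q \<Longrightarrow> \<psi> q \<in> {0<..1}"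
    and anti: "antimono_on {1..} \<psi>"
    and lim: "(\<lambda>q. (real q)\<^sup>2 * \<psi> q) \<longlonglongrightarrow> 0"
    and up: "upper_order (\<lambda>q. 1 / \<psi> q) = ereal lam"
    and lam: "2 \<le> lam" and dim: "3 \<le> CARD('n::finite)"
    and u: "0 < u" "u < (real CARD('n) + 1) / lam"
  shows "hausdorff_measure u (exactly_approximable \<psi> :: (real ^ 'n) set) \<noteq> 0"
proof -
  let ?n = "real CARD('n)"
  have "lam < (?n + 1) / u" using u lam by (simp add: field_simps)
  then obtain mu where mu: "lam < mu" "mu < (?n + 1) / u" using dense by blast
  have umu: "u * mu < ?n + 1" using mu(2) u by (simp add: field_simps)
  have m: "real (CARD('n) - 1) = ?n - 1" using dim by (simp add: of_nat_diff)
  have "(u * mu - real (CARD('n) - 1)) / 2 < 1" using umu m by simp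
  then obtain b :: nat and \<theta> :: real where b: "4 \<le> b" "0 < \<theta>" "real b powr \<theta> = real (b - 3)"
    "(u * mu - real (CARD('n) - 1)) / 2 < \<theta>" by (rule branching_exponent_exists)
  have b2: "0 < 128 * real b ^ 2" using b by simp
  have "((\<lambda>q. 128 * real b ^ 2 * (real q ^ 2 * \<psi> q)) \<longlongrightarrow> 128 * real b ^ 2 * 0) sequentially"
    by (intro tendsto_intros lim)
  then have "\<forall>\<^sub>F q in sequentially. 128 * real b ^ 2 * (real q ^ 2 * \<psi> q) < 1"
    by (rule order_tendstoD) simp
  moreover have "\<forall>\<^sub>F q in sequentially. real q powr - mu < \<psi> q"
    by (rule eventually_greater_powr[OF _ up mu(1)]) (use \<psi> in auto)
  ultimately have "\<forall>\<^sub>F q in sequentially. 128 * real b ^ 2 * (real q ^ 2 * \<psi> q) < 1 \<and> real q powr - mu < \<psi> q"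
    by (rule eventually_conj)
  then obtain s1 where s1: "\<And>q. s1 \<le> q \<Longrightarrow> 128 * real b ^ 2 * (real q ^ 2 * \<psi> q) < 1 \<and> real q powr - mu < \<psi> q"
    unfolding eventually_sequentially by blast
  define s0 where "s0 = max 2 s1"
  \<comment> \<open>Any coordinate can carry exactness.\<close>
  interpret exact_tree \<psi> "undefined :: 'n" b s0 u mu \<theta>
  proof
    show "\<psi> q' \<le> \<psi> q" if "1 \<le> q" "q \<le> q'" for q q'
      using monotone_onD[OF anti, of q q'] that by simp
    show "2 \<le> s0" by (simp add: s0_def)
    show "128 * real b ^ 2 * (real q ^ 2 * \<psi> q) \<le> 1" "real q powr - mu \<le> \<psi> q" if "s0 \<le> q" for q
      using s1[of q] that by (auto simp: s0_def)
    show "u \<le> real (CARD('n) - 1)"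
    proof -
      have "(?n + 1) / lam \<le> (?n + 1) / 2" using lam by (intro divide_left_mono) auto
      then have "u \<le> (?n + 1) / 2" using u(2) by (meson less_imp_le less_le_trans)
      also have "\<dots> \<le> ?n - 1" using dim by (simp add: field_simps)
      finally show ?thesis unfolding m .
    qed
    show "2 \<le> mu" using lam mu by linarith
    have "u * mu - real (CARD('n) - 1) < \<theta> * 2"
      using b(4) by (simp only: pos_divide_less_eq zero_less_numeral)
    then show "u * mu < 2 * \<theta> + real (CARD('n) - 1)" by (simp only: diff_less_eq mult.commute)
  qed (use \<psi> lim b u dim in \<open>auto simp del: greaterThanAtMost_iff\<close>)
  show ?thesis by (rule hausdorff_measure_exactly_approximable)
qed

theorem theorem1p2:
  fixes \<psi> :: "nat \<Rightarrow> real" and lam :: real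
  assumes "\<And>q. 1 \<le> q \<Longrightarrow> \<psi> q \<in> {0<..1}"
    and "antimono_on {1..} \<psi>"
    and "(\<lambda>q. (real q)\<^sup>2 * \<psi> q) \<longlonglongrightarrow> 0"
    and "upper_order (\<lambda>q. 1 / \<psi> q) = ereal lam"
    and "lower_order (\<lambda>q. 1 / \<psi> q) = ereal lam"
    and "2 \<le> lam"
    and "3 \<le> CARD('n::finite)"
  shows "hausdorff_dim (exactly_approximable \<psi> :: (real ^ 'n) set)
           = hausdorff_dim (well_approximable \<psi> :: (real ^ 'n) set)
       \<and> hausdorff_dim (well_approximable \<psi> :: (real ^ 'n) set)
           = ereal ((real CARD('n) + 1) / lam)"
proof -
  let ?E = "exactly_approximable \<psi> :: (real ^ 'n) set" and ?W = "well_approximable \<psi> :: (real ^ 'n) set"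
  have "hausdorff_dim ?W \<le> ereal ((real CARD('n) + 1) / lam)"
    by (rule hausdorff_dim_well_approximable_le) (use assms in auto)
  moreover have "ereal ((real CARD('n) + 1) / lam) \<le> hausdorff_dim ?E"
  proof (rule hausdorff_dim_geI)
    show "0 < (real CARD('n) + 1) / lam" using assms(6) by (intro divide_pos_pos) auto
    show "hausdorff_measure u ?E \<noteq> 0" if "0 < u" "u < (real CARD('n) + 1) / lam" for u
      using assms that by (intro hausdorff_measure_exactly_approximable_ne_0) auto
  qed
  moreover have "hausdorff_dim ?E \<le> hausdorff_dim ?W"
    by (rule hausdorff_dim_mono) (auto simp: exactly_approximable_def)
  ultimately show ?thesis by (metis antisym order_trans)
qed

end
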